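(* Let $s<-2$ and let $T>0$ be arbitrary. Then there does not exist any space $X_T$ such that, for some constant $c>0$, $$\|u\|_{C([0,T]:H^s(\mathbb{R}))}\leq c\,\|u\|_{X_T}\quad\text{for all }u\in X_T,$$ $$\|V_c(t)\phi+V_s(t)\psi_x\|_{X_T}\leq c\left(\|\phi\|_{H^s(\mathbb{R})}+\|\psi\|_{H^{s-1}(\mathbb{R})}\right)\quad\text{for all }\phi\in H^s(\mathbb{R}),\ \psi\in H^{s-1}(\mathbb{R}),$$ and $$\left\|\int_0^tV_s(t-t')(uv)_{xx}(t')\,dt'\right\|_{X_T}\leq c\,\|u\|_{X_T}\|v\|_{X_T}\quad\text{for all }u,v\in X_T.$$
   Context: $\langle a\rangle=1+|a|$; $H^s(\mathbb{R})$ is the Sobolev space with norm $\|f\|_{H^s}=\|\langle\xi\rangle^s\widehat f\|_{L^2}$, and $C([0,T]:H^s(\mathbb{R}))$ carries the supremum norm. With $\gamma(\xi)=\sqrt{\xi^2+\xi^4}$, define via the spatial Fourier transform $$\widehat{V_c(t)\phi}(\xi)=\frac{e^{it\gamma(\xi)}+e^{-it\gamma(\xi)}}{2}\,\widehat\phi(\xi),\qquad \widehat{V_s(t)g}(\xi)=\frac{e^{it\gamma(\xi)}-e^{-it\gamma(\xi)}}{2i\gamma(\xi)}\,\widehat g(\xi).$$ "Space $X_T$" means a normed space of (distribution-valued) functions of $(t,x)\in[0,T]\times\mathbb{R}$; each displayed inequality implicitly includes the statement that the object on its left-hand side belongs to the indicated space. In the third inequality, the product $uv$ and the time integral have their usual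 meaning whenever $u,v$ are smooth functions for which these are classically defined (e.g. $u=V_c(t)\phi$, $v=V_c(t)\rho$ with $\widehat\phi,\widehat\rho$ bounded and compactly supported). *)

theory Defs
  imports "HOL-Analysis.Analysis"
begin

section \<open>Schwartz functions and tempered distributions on the real line\<close>

definition vderiv :: "(real \<Rightarrow> complex) \<Rightarrow> real \<Rightarrow> complex" where
  "vderiv f = (\<lambda>x. vector_derivative f (at x))"

definition schwartz :: "(real \<Rightarrow> complex) set" where
  "schwartz = {f. \<forall>k. (\<forall>x. (vderiv ^^ k) f differentiable (at x)) \<and>
                      (\<forall>j. bounded (range (\<lambda>x. x ^ j *\<^sub>R (vderiv ^^ k) f x)))}"

definition schwartz_seminorm :: "nat \<Rightarrow> nat \<Rightarrow> (real \<Rightarrow> complex) \<Rightarrow> real" where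
  "schwartz_seminorm j k f = (SUP x. norm (x ^ j *\<^sub>R (vderiv ^^ k) f x))"

text \<open>Distributions are functionals on \<^const>\<open>schwartz\<close>. They are made total by the value 0 off
  \<^const>\<open>schwartz\<close>, so that equality of distributions is equality in HOL.\<close>

type_synonym functional = "(real \<Rightarrow> complex) \<Rightarrow> complex"

definition tempered :: "functional set" where
  "tempered = {u.
     (\<forall>f. f \<notin> schwartz \<longrightarrow> u f = 0) \<and>
     (\<forall>f\<in>schwartz. \<forall>g\<in>schwartz. u (\<lambda>x. f x + g x) = u f + u g) \<and>
     (\<forall>a. \<forall>f\<in>schwartz. u (\<lambda>x. a * f x) = a * u f) \<and>
     (\<exists>C n. \<forall>f\<in>schwartz. norm (u f) \<le> C * (\<Sum>j\<le>n. \<Sum>k\<le>n. schwartz_seminorm j k f))}"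

definition dist_deriv :: "functional \<Rightarrow> functional" where
  "dist_deriv u = (\<lambda>f. if f \<in> schwartz then - u (vderiv f) else 0)"

definition fourier :: "(real \<Rightarrow> complex) \<Rightarrow> real \<Rightarrow> complex" where
  "fourier f \<xi> = (\<integral>x. cis (- (x * \<xi>)) * f x \<partial>lborel)"

definition dist_fourier :: "functional \<Rightarrow> functional" where
  "dist_fourier u = (\<lambda>f. if f \<in> schwartz then u (fourier f) else 0)"

definition tempered_fun :: "(real \<Rightarrow> complex) \<Rightarrow> bool" where
  "tempered_fun F \<longleftrightarrow> F \<in> borel_measurable lborel \<and> (\<forall>f\<in>schwartz. integrable lborel (\<lambda>x. F x * f x))"

definition regular_dist :: "(real \<Rightarrow> complex) \<Rightarrow> functional" where
  "regular_dist F = (\<lambda>f. if f \<in> schwartz then (\<integral>x. F x * f x \<partial>lborel) else 0)"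

definition has_fourier :: "functional \<Rightarrow> (real \<Rightarrow> complex) \<Rightarrow> bool" where
  "has_fourier u g \<longleftrightarrow> tempered_fun g \<and> dist_fourier u = regular_dist g"

text \<open>The density \<open>g\<close> in \<^const>\<open>has_fourier\<close> is unique almost everywhere; any choice will do.\<close>

definition fourier_fun :: "functional \<Rightarrow> real \<Rightarrow> complex" where
  "fourier_fun u = (SOME g. has_fourier u g)"


section \<open>Sobolev spaces\<close>

definition bracket :: "real \<Rightarrow> real" where
  "bracket a = 1 + \<bar>a\<bar>"

definition sobolev :: "real \<Rightarrow> functional set" where
  "sobolev s = {u \<in> tempered. \<exists>g. has_fourier u g \<and>
                  integrable lborel (\<lambda>\<xi>. (bracket \<xi> powr s * norm (g \<xi>))\<^sup>2)}"

definition sobolev_norm :: "real \<Rightarrow> functional \<Rightarrow> real" where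
  "sobolev_norm s u = sqrt (\<integral>\<xi>. (bracket \<xi> powr s * norm (fourier_fun u \<xi>))\<^sup>2 \<partial>lborel)"

definition C_sobolev :: "real \<Rightarrow> real \<Rightarrow> (real \<Rightarrow> functional) set" where
  "C_sobolev T s = {u. \<forall>t\<in>{0..T}. u t \<in> sobolev s \<and>
     ((\<lambda>\<tau>. sobolev_norm s (\<lambda>f. u \<tau> f - u t f)) \<longlongrightarrow> 0) (at t within {0..T})}"

definition C_sobolev_norm :: "real \<Rightarrow> real \<Rightarrow> (real \<Rightarrow> functional) \<Rightarrow> real" where
  "C_sobolev_norm T s u = (SUP t\<in>{0..T}. sobolev_norm s (u t))"


section \<open>The linear evolution\<close>

definition \<gamma> :: "real \<Rightarrow> real" where
  "\<gamma> \<xi> = sqrt (\<xi>\<^sup>2 + \<xi> ^ 4)"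

definition fourier_mult :: "(real \<Rightarrow> complex) \<Rightarrow> functional \<Rightarrow> functional" where
  "fourier_mult m u = (THE w. w \<in> tempered \<and> has_fourier w (\<lambda>\<xi>. m \<xi> * fourier_fun u \<xi>))"

definition Vc :: "real \<Rightarrow> functional \<Rightarrow> functional" where
  "Vc t = fourier_mult (\<lambda>\<xi>. (cis (t * \<gamma> \<xi>) + cis (- (t * \<gamma> \<xi>))) / 2)"

text \<open>At \<open>\<xi> = 0\<close> the quotient is 0 in HOL instead of its limit \<open>t\<close>; this is a null set.\<close>

definition Vs :: "real \<Rightarrow> functional \<Rightarrow> functional" where
  "Vs t = fourier_mult
     (\<lambda>\<xi>. (cis (t * \<gamma> \<xi>) - cis (- (t * \<gamma> \<xi>))) / (2 * \<i> * complex_of_real (\<gamma> \<xi>)))"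


section \<open>Normed spaces of distribution-valued functions on the interval from 0 to T\<close>

text \<open>Functions on \<open>{0..T}\<close> are extended by 0, so that their equality is equality in HOL.\<close>

definition on_interval :: "real \<Rightarrow> (real \<Rightarrow> functional) \<Rightarrow> real \<Rightarrow> functional" where
  "on_interval T u = (\<lambda>t. if t \<in> {0..T} then u t else (\<lambda>_. 0))"

text \<open>Only real scalars are required; every complex normed space is in particular a real one.\<close>

definition normed_dist_space ::
    "real \<Rightarrow> (real \<Rightarrow> functional) set \<Rightarrow> ((real \<Rightarrow> functional) \<Rightarrow> real) \<Rightarrow> bool" where
  "normed_dist_space T X N \<longleftrightarrow>
     (\<forall>u\<in>X. on_interval T u = u \<and> (\<forall>t. u t \<in> tempered)) \<and>
     (\<lambda>_ _. 0) \<in> X \<and>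
     (\<forall>u\<in>X. \<forall>v\<in>X. (\<lambda>t f. u t f + v t f) \<in> X \<and> N (\<lambda>t f. u t f + v t f) \<le> N u + N v) \<and>
     (\<forall>a::real. \<forall>u\<in>X. (\<lambda>t f. a *\<^sub>R u t f) \<in> X \<and> N (\<lambda>t f. a *\<^sub>R u t f) = \<bar>a\<bar> * N u) \<and>
     (\<forall>u\<in>X. 0 \<le> N u \<and> (N u = 0 \<longleftrightarrow> u = (\<lambda>_ _. 0)))"


section \<open>The Duhamel term\<close>

text \<open>\<open>D i j\<close> is the mixed partial derivative of order \<open>i\<close> in time and \<open>j\<close> in space; the time
  derivatives are one-sided at the end points.\<close>

definition smooth_strip :: "real \<Rightarrow> (real \<Rightarrow> real \<Rightarrow> complex) \<Rightarrow> bool" where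
  "smooth_strip T U \<longleftrightarrow> (\<exists>D :: nat \<Rightarrow> nat \<Rightarrow> real \<Rightarrow> real \<Rightarrow> complex.
     D 0 0 = U \<and>
     (\<forall>i j. continuous_on ({0..T} \<times> UNIV) (\<lambda>(t, x). D i j t x) \<and>
       (\<forall>t\<in>{0..T}. \<forall>x.
         ((\<lambda>\<tau>. D i j \<tau> x) has_vector_derivative D (Suc i) j t x) (at t within {0..T}) \<and>
         (D i j t has_vector_derivative D i (Suc j) t x) (at x))))"

definition smooth_rep :: "real \<Rightarrow> (real \<Rightarrow> functional) \<Rightarrow> (real \<Rightarrow> real \<Rightarrow> complex) \<Rightarrow> bool" where
  "smooth_rep T u U \<longleftrightarrow> smooth_strip T U \<and>
     (\<forall>t\<in>{0..T}. tempered_fun (U t) \<and> u t = regular_dist (U t))"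

definition duhamel_integrand ::
    "(real \<Rightarrow> real \<Rightarrow> complex) \<Rightarrow> (real \<Rightarrow> real \<Rightarrow> complex) \<Rightarrow> real \<Rightarrow> real \<Rightarrow> functional" where
  "duhamel_integrand U V t t' =
     Vs (t - t') (dist_deriv (dist_deriv (regular_dist (\<lambda>x. U t' x * V t' x))))"

text \<open>The product is the pointwise one, and it has to be a tempered distribution whose Fourier
  transform is a function, as needed for the definition of \<^const>\<open>Vs\<close>. The time integral is the
  integral of a distribution-valued function, taken after pairing with a test function.\<close>

definition duhamel_defined ::
    "real \<Rightarrow> (real \<Rightarrow> real \<Rightarrow> complex) \<Rightarrow> (real \<Rightarrow> real \<Rightarrow> complex) \<Rightarrow> bool" where
  "duhamel_defined T U V \<longleftrightarrow>
     (\<forall>t\<in>{0..T}. tempered_fun (\<lambda>x. U t x * V t x) \<and>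
        (\<exists>g. has_fourier (regular_dist (\<lambda>x. U t x * V t x)) g)) \<and>
     (\<forall>t\<in>{0..T}. \<forall>f\<in>schwartz.
        set_integrable lborel {0..t} (\<lambda>t'. duhamel_integrand U V t t' f))"

definition duhamel ::
    "real \<Rightarrow> (real \<Rightarrow> real \<Rightarrow> complex) \<Rightarrow> (real \<Rightarrow> real \<Rightarrow> complex) \<Rightarrow> real \<Rightarrow> functional" where
  "duhamel T U V =
     on_interval T (\<lambda>t f. LINT t':{0..t}|lborel. duhamel_integrand U V t t' f)"

text \<open>For general \<open>u\<close> and \<open>v\<close> in the space the product \<open>uv\<close> has no intrinsic meaning. \<open>B\<close> is any
  interpretation of the Duhamel term that agrees with the usual one on all pairs of smooth
  functions for which the latter is classically defined.\<close>

definition duhamel_interpretation ::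
    "real \<Rightarrow> (real \<Rightarrow> functional) set \<Rightarrow>
     ((real \<Rightarrow> functional) \<Rightarrow> (real \<Rightarrow> functional) \<Rightarrow> real \<Rightarrow> functional) \<Rightarrow> bool" where
  "duhamel_interpretation T X B \<longleftrightarrow>
     (\<forall>u\<in>X. \<forall>v\<in>X. \<forall>U V. smooth_rep T u U \<and> smooth_rep T v V \<and> duhamel_defined T U V \<longrightarrow>
        B u v = duhamel T U V)"

end

theory Submission
  imports Defs "HOL-Probability.Levy"
begin

text \<open>
The space is tested on a single quadratic iterate. Take as initial data \<open>\<phi>\<close> the function whose Fourier
transform is the indicator of \<open>n \<le> \<bar>\<xi>\<bar> \<le> n + 1\<close>, with \<open>\<psi> = 0\<close>. Its \<open>H\<^sup>s\<close> norm is of size \<open>n powr s\<close>, so the linear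
estimate puts the free wave \<open>u = V\<^sub>c \<phi>\<close> into the space with norm at most a constant times \<open>n powr s\<close>. As \<open>u\<close> is
smooth, the Duhamel term of \<open>u\<close> with itself is the classical one. The bilinear estimate and the
embedding then bound its \<open>H\<^sup>s\<close> norm by a constant times \<open>n powr (2 * s)\<close>, uniformly in time.

On the Fourier side the Duhamel term at time \<open>t\<close> is
\<open>- \<xi>\<^sup>2 \<integral>\<^sub>0\<^sup>t sin ((t - t') \<gamma> \<xi>) / \<gamma> \<xi> \<cdot> (h\<^sub>t\<^sub>' * h\<^sub>t\<^sub>') \<xi> / (2 \<pi>) dt'\<close>, where \<open>*\<close> is convolution and
\<open>h\<^sub>t \<eta> = cos (t \<gamma> \<eta>)\<close> on the band. The evaluation takes place at the time \<open>t = 1 / (8 n\<^sup>2)\<close>, which is so short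
that no phase \<open>t \<gamma> \<eta>\<close> with \<open>\<eta>\<close> in the band exceeds \<open>1\<close>: all cosines are at least \<open>1 / 2\<close>. Frequencies near \<open>n\<close>
and near \<open>- n\<close> interact to produce output at \<open>\<xi>\<close> between \<open>1 / 4\<close> and \<open>1 / 2\<close>. All contributions to it have the
same sign, and the result is of size \<open>t\<^sup>2\<close>, that is \<open>n powr (- 4)\<close> (\<open>duhamel_symbol_high_band_ge\<close>). At these
frequencies the Sobolev weight is harmless. Hence \<open>n powr (- 4)\<close> is at most a constant times \<open>n powr (2 * s)\<close> for
all large \<open>n\<close>, which is false for \<open>s < -2\<close>. A short time suffices because the embedding controls the
supremum over all times.

Most of the work is to evaluate the definitions, which are phrased with tempered distributions.
The Fourier transform maps Schwartz functions to Schwartz functions and is inverted by the usual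
formula (\<open>osc_integral_inversion\<close>). A density is determined almost everywhere by its pairings with
Schwartz functions (\<open>regular_dist_unique\<close>). So a distribution with integrable Fourier transform \<open>G\<close> is
the bounded function \<open>inv_fourier G\<close>, and Fourier multipliers act on it by multiplication
(\<open>fourier_mult_eq\<close>). Products become convolutions (\<open>inv_fourier_mult\<close>), and for data with bounded and
compactly supported Fourier transform the free wave is smooth (\<open>smooth_strip_free_wave\<close>) and the
Duhamel term is computed by Fubini's theorem (\<open>duhamel_free_wave\<close>).
\<close>

section \<open>Schwartz functions\<close>

lemma has_vector_derivative_vderiv:
  assumes "f differentiable (at x)"
  shows "(f has_vector_derivative vderiv f x) (at x)"
  using assms by (simp add: vderiv_def vector_derivative_works[symmetric])

lemma vderiv_eqI:
  assumes "\<And>x. (f has_vector_derivative g x) (at x)"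
  shows "vderiv f = g"
  using assms by (auto simp: vderiv_def vector_derivative_at)

lemma schwartz_differentiable: "f \<in> schwartz \<Longrightarrow> (vderiv ^^ k) f differentiable (at x)"
  by (simp add: schwartz_def)

lemma schwartz_bounded: "f \<in> schwartz \<Longrightarrow> bounded (range (\<lambda>x. x ^ j *\<^sub>R (vderiv ^^ k) f x))"
  by (simp add: schwartz_def)

lemma schwartz_has_vector_derivative:
  "f \<in> schwartz \<Longrightarrow> ((vderiv ^^ k) f has_vector_derivative (vderiv ^^ Suc k) f x) (at x)"
  using has_vector_derivative_vderiv[OF schwartz_differentiable] by simp

lemma schwartz_vderiv_at: "f \<in> schwartz \<Longrightarrow> (f has_vector_derivative vderiv f x) (at x)"
  using schwartz_has_vector_derivative[of f 0] by simp

lemma schwartz_vderiv: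
  assumes "f \<in> schwartz"
  shows "vderiv f \<in> schwartz"
proof -
  have "(vderiv ^^ k) (vderiv f) = (vderiv ^^ Suc k) f" for k
    by (simp only: funpow_Suc_right o_apply)
  then show ?thesis
    unfolding schwartz_def mem_Collect_eq
    using schwartz_differentiable[OF assms] schwartz_bounded[OF assms] by presburger
qed

text \<open>Membership in \<^const>\<open>schwartz\<close> asks for all mixed seminorms at once. A class of bounded
  differentiable functions that is stable under differentiation and under multiplication by the
  variable contains all \<open>x\<^sup>j f\<^sup>(\<^sup>k\<^sup>)\<close> together with \<open>f\<close>, so it consists of Schwartz functions. This
  spares the explicit computation of higher derivatives of Fourier transforms and Gaussians.\<close>

lemma schwartz_coinduct:
  assumes "f \<in> Q"
  assumes step: "\<And>f. f \<in> Q \<Longrightarrow> (\<forall>x. f differentiable (at x)) \<and> vderiv f \<in> Q \<and>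
      (\<lambda>x. complex_of_real x * f x) \<in> Q \<and> bounded (range f)"
  shows "f \<in> schwartz"
proof -
  have "(vderiv ^^ k) f \<in> Q" for k
    using \<open>f \<in> Q\<close> by (induction k) (auto dest: step)
  moreover have "h \<in> Q \<Longrightarrow> (\<lambda>x. x ^ j *\<^sub>R h x) \<in> Q" for h j
  proof (induction j)
    case (Suc j)
    then show ?case
      using step[of "\<lambda>x. x ^ j *\<^sub>R h x"] by (simp add: scaleR_conv_of_real mult.assoc)
  qed simp
  ultimately show ?thesis
    unfolding schwartz_def using step by blast
qed

lemma schwartz_continuous: "f \<in> schwartz \<Longrightarrow> continuous_on UNIV f"
  using schwartz_differentiable[of f 0]
  by (auto intro!: continuous_at_imp_continuous_on differentiable_imp_continuous_within)

lemma schwartz_measurable [measurable_dest]: "f \<in> schwartz \<Longrightarrow> f \<in> borel_measurable borel"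
  by (rule borel_measurable_continuous_onI) (rule schwartz_continuous)

text \<open>Leibniz' rule for the product with \<open>x\<close>, whose derivatives vanish from the second on. For
  \<open>k = 0\<close> the truncated value of \<open>k - 1\<close> is harmless because of the factor \<open>k\<close>.\<close>

lemma vderiv_mult_x_iterate:
  assumes "f \<in> schwartz"
  shows "(vderiv ^^ k) (\<lambda>x. complex_of_real x * f x) =
    (\<lambda>x. complex_of_real x * (vderiv ^^ k) f x + of_nat k * (vderiv ^^ (k - 1)) f x)"
proof (induction k)
  case (Suc k)
  show ?case
  proof (cases k)
    case 0
    show ?thesis
      using 0 by (auto intro!: vderiv_eqI derivative_eq_intros schwartz_vderiv_at[OF assms])
  next
    case (Suc m)
    show ?thesis
      unfolding funpow.simps(2)[of k] o_def[of vderiv "vderiv ^^ k"] Suc.IH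
      unfolding Suc
      by (rule vderiv_eqI)
        (auto intro!: derivative_eq_intros
          schwartz_has_vector_derivative[OF assms, of m, simplified]
          schwartz_has_vector_derivative[OF assms, of "Suc m", simplified] simp: algebra_simps)
  qed
qed simp

lemma bounded_range_cmult:
  fixes h :: "real \<Rightarrow> complex"
  assumes "bounded (range h)"
  shows "bounded (range (\<lambda>x. a * h x))"
  using bounded_linear_image[OF assms bounded_linear_mult_right[of a]] by (simp add: image_image)

lemma schwartz_mult_x:
  assumes "f \<in> schwartz"
  shows "(\<lambda>x. complex_of_real x * f x) \<in> schwartz"
  unfolding schwartz_def mem_Collect_eq vderiv_mult_x_iterate[OF assms]
proof (intro allI conjI)
  fix k j x
  show "(\<lambda>x. complex_of_real x * (vderiv ^^ k) f x + of_nat k * (vderiv ^^ (k - 1)) f x)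
      differentiable at x"
    using schwartz_differentiable[OF assms] 
    by (intro derivative_intros) auto
  have "bounded (range (\<lambda>x. x ^ Suc j *\<^sub>R (vderiv ^^ k) f x))"
    and "bounded (range (\<lambda>x. complex_of_nat k * (x ^ j *\<^sub>R (vderiv ^^ (k-1)) f x)))"
    by (rule schwartz_bounded[OF assms], rule bounded_range_cmult[OF schwartz_bounded[OF assms]])
  from bounded_plus_comp[OF this]
  show "bounded (range (\<lambda>x. x ^ j *\<^sub>R (complex_of_real x * (vderiv ^^ k) f x
      + of_nat k * (vderiv ^^ (k - 1)) f x)))"
    by (simp add: scaleR_conv_of_real algebra_simps)
qed

lemma vderiv_cmult_iterate:
  assumes "f \<in> schwartz"
  shows "(vderiv ^^ k) (\<lambda>x. a * f x) = (\<lambda>x. a * (vderiv ^^ k) f x)"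
proof (induction k)
  case (Suc k)
  then show ?case
    by (auto intro!: vderiv_eqI derivative_eq_intros
      schwartz_has_vector_derivative[OF assms, simplified])
qed simp

lemma schwartz_cmult:
  assumes "f \<in> schwartz"
  shows "(\<lambda>x. a * f x) \<in> schwartz"
  unfolding schwartz_def mem_Collect_eq vderiv_cmult_iterate[OF assms]
proof (intro allI conjI)
  fix k j x
  show "(\<lambda>x. a * (vderiv ^^ k) f x) differentiable at x"
    using schwartz_differentiable[OF assms] by (intro derivative_intros) auto
  show "bounded (range (\<lambda>x. x ^ j *\<^sub>R (a * (vderiv ^^ k) f x)))"
    using bounded_range_cmult[OF schwartz_bounded[OF assms]] by (simp only: mult_scaleR_right)
qed

lemma vderiv_add_iterate:
  assumes "f \<in> schwartz" "g \<in> schwartz"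
  shows "(vderiv ^^ k) (\<lambda>x. f x + g x) = (\<lambda>x. (vderiv ^^ k) f x + (vderiv ^^ k) g x)"
proof (induction k)
  case (Suc k)
  then show ?case
    by (auto intro!: vderiv_eqI derivative_eq_intros
      schwartz_has_vector_derivative[OF assms(1), simplified]
      schwartz_has_vector_derivative[OF assms(2), simplified])
qed simp

lemma schwartz_add:
  assumes "f \<in> schwartz" "g \<in> schwartz"
  shows "(\<lambda>x. f x + g x) \<in> schwartz"
  unfolding schwartz_def mem_Collect_eq vderiv_add_iterate[OF assms] scaleR_add_right
  using assms by (auto intro!: derivative_intros schwartz_differentiable bounded_plus_comp schwartz_bounded)

lemma norm_le_schwartz_seminorm:
  assumes "f \<in> schwartz"
  shows "norm (x ^ j *\<^sub>R (vderiv ^^ k) f x) \<le> schwartz_seminorm j k f"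
  unfolding schwartz_seminorm_def
proof (rule cSUP_upper)
  show "bdd_above (range (\<lambda>x. norm (x ^ j *\<^sub>R (vderiv ^^ k) f x)))"
    using schwartz_bounded[OF assms, of j k] unfolding bdd_above_def bounded_iff by auto
qed simp

lemma schwartz_seminorm_nonneg: "f \<in> schwartz \<Longrightarrow> 0 \<le> schwartz_seminorm j k f"
  using norm_le_schwartz_seminorm[of f 0 j k] norm_ge_zero order_trans by blast

lemma integrable_inverse_1_plus_square_lborel:
  "integrable lborel (\<lambda>x::real. inverse (1 + x\<^sup>2))"
  using integrable_inverse_1_plus_square by (simp add: set_integrable_def einterval_eq_UNIV)

lemma integral_inverse_1_plus_square_lborel:
  "(\<integral>x. inverse (1 + x\<^sup>2) \<partial>lborel) = pi"
  using LBINT_inverse_1_plus_square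
  by (simp add: interval_lebesgue_integral_def set_lebesgue_integral_def einterval_eq_UNIV)

text \<open>Two seminorms control a function by an integrable weight; they bound its \<open>L\<^sup>1\<close> norm, and that is all
  that is ever needed to see that a functional is tempered.\<close>

lemma schwartz_decay:
  assumes "f \<in> schwartz"
  shows "norm (f x) \<le> (schwartz_seminorm 0 0 f + schwartz_seminorm 2 0 f) * inverse (1 + x\<^sup>2)"
proof -
  have "norm (f x) + x\<^sup>2 * norm (f x) \<le> schwartz_seminorm 0 0 f + schwartz_seminorm 2 0 f"
    using norm_le_schwartz_seminorm[OF assms, of x 0 0] norm_le_schwartz_seminorm[OF assms, of x 2 0]
    by (simp add: norm_mult norm_power)
  then have "norm (f x) * (1 + x\<^sup>2) \<le> schwartz_seminorm 0 0 f + schwartz_seminorm 2 0 f"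
    by (simp add: algebra_simps)
  then show ?thesis
    by (subst divide_inverse[symmetric], subst pos_le_divide_eq) (auto intro: add_pos_nonneg)
qed

lemma schwartz_integrable:
  assumes "f \<in> schwartz"
  shows "integrable lborel f"
proof (rule Bochner_Integration.integrable_bound)
  show "integrable lborel (\<lambda>x. (schwartz_seminorm 0 0 f + schwartz_seminorm 2 0 f) * inverse (1 + x\<^sup>2))"
    using integrable_inverse_1_plus_square_lborel by simp
  show "f \<in> borel_measurable lborel" using schwartz_measurable[OF assms] by simp
  show "AE x in lborel. norm (f x) \<le>
      norm ((schwartz_seminorm 0 0 f + schwartz_seminorm 2 0 f) * inverse (1 + x\<^sup>2))"
    using schwartz_decay[OF assms] by (auto intro: order_trans abs_ge_self)
qed

lemma schwartz_L1_bound: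
  assumes "f \<in> schwartz"
  shows "(\<integral>x. norm (f x) \<partial>lborel) \<le> pi * (schwartz_seminorm 0 0 f + schwartz_seminorm 2 0 f)"
proof -
  have "(\<integral>x. norm (f x) \<partial>lborel) \<le>
    (\<integral>x. (schwartz_seminorm 0 0 f + schwartz_seminorm 2 0 f) * inverse (1 + x\<^sup>2) \<partial>lborel)"
    using schwartz_integrable[OF assms] schwartz_decay[OF assms] integrable_inverse_1_plus_square_lborel
    by (intro integral_mono) auto
  then show ?thesis
    using integral_inverse_1_plus_square_lborel by (simp add: mult.commute)
qed

lemma schwartz_sup_bound: "f \<in> schwartz \<Longrightarrow> norm (f x) \<le> schwartz_seminorm 0 0 f"
  using norm_le_schwartz_seminorm[of f x 0 0] by simp

lemma schwartz_at_infinity: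
  assumes "f \<in> schwartz"
  shows "(f \<longlongrightarrow> 0) at_top" "(f \<longlongrightarrow> 0) at_bot"
proof -
  have *: "((\<lambda>x. (schwartz_seminorm 0 0 f + schwartz_seminorm 2 0 f) * inverse (1 + x\<^sup>2)) \<longlongrightarrow> 0) F"
    if "LIM x F. x\<^sup>2 :> at_top" for F :: "real filter"
    using that
    by (intro tendsto_mult_right_zero tendsto_inverse_0_at_top
       filterlim_tendsto_add_at_top[OF tendsto_const])
  have sq: "LIM x at_top. (x::real)\<^sup>2 :> at_top" "LIM x at_bot. (x::real)\<^sup>2 :> at_top"
    by (auto intro: filterlim_pow_at_top filterlim_pow_at_bot_even filterlim_ident)
  show "(f \<longlongrightarrow> 0) at_top" "(f \<longlongrightarrow> 0) at_bot"
    by (rule Lim_null_comparison[OF always_eventually *], use schwartz_decay[OF assms] sq in auto)+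
qed

section \<open>Oscillatory integrals\<close>

lemma borel_measurable_cis [measurable]: "cis \<in> borel_measurable borel"
  by (intro borel_measurable_continuous_onI continuous_intros)

lemma integrable_cis_mult:
  fixes K :: "'a \<Rightarrow> complex"
  assumes "integrable M K" and [measurable]: "\<theta> \<in> borel_measurable M"
  shows "integrable M (\<lambda>x. cis (\<theta> x) * K x)"
proof (rule Bochner_Integration.integrable_bound[OF assms(1)])
  have [measurable]: "K \<in> borel_measurable M" using assms(1) by auto
  show "(\<lambda>x. cis (\<theta> x) * K x) \<in> borel_measurable M" by measurable
qed (simp add: norm_mult)

lemma norm_cis_taylor2: "norm (cis (a + h) - cis a - \<i> * of_real h * cis a) \<le> h\<^sup>2 / 2"
proof -
  have "cis (a + h) - cis a - \<i> * of_real h * cis a = cis a * (cis h - (1 + \<i> * of_real h))"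
    by (simp add: algebra_simps cis_mult)
  moreover have "norm (cis h - (1 + \<i> * of_real h)) \<le> h\<^sup>2 / 2"
    using iexp_approx1[of h 1] by (simp add: cis_conv_exp power2_eq_square)
  ultimately show ?thesis by (simp add: norm_mult)
qed

text \<open>Differentiation under the integral sign. The second-order Taylor remainder of \<^const>\<open>cis\<close> makes the
  error quadratic in the increment with constant \<open>\<integral> \<theta>\<^sup>2 \<bar>K\<bar>\<close>, so integrability
  of the first two moments of \<open>K\<close> replaces continuity, and indicators of frequency bands are covered.\<close>

lemma has_vector_derivative_cis_integral:
  fixes K :: "'a \<Rightarrow> complex" and \<theta> \<beta> :: "'a \<Rightarrow> real"
  assumes [measurable]: "\<theta> \<in> borel_measurable M" "\<beta> \<in> borel_measurable M"
    and K: "integrable M K" "integrable M (\<lambda>x. of_real (\<theta> x) * K x)"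
      "integrable M (\<lambda>x. of_real ((\<theta> x)\<^sup>2) * K x)"
  shows "((\<lambda>\<tau>. \<integral>x. cis (\<tau> * \<theta> x + \<beta> x) * K x \<partial>M) has_vector_derivative
     (\<integral>x. cis (\<tau> * \<theta> x + \<beta> x) * (\<i> * of_real (\<theta> x) * K x) \<partial>M)) (at \<tau> within S)"
  unfolding has_vector_derivative_def
proof (rule has_derivativeI_sandwich[of 1])
  let ?I = "\<lambda>\<tau>. \<integral>x. cis (\<tau> * \<theta> x + \<beta> x) * K x \<partial>M"
  let ?D = "\<integral>x. cis (\<tau> * \<theta> x + \<beta> x) * (\<i> * of_real (\<theta> x) * K x) \<partial>M"
  let ?C = "\<integral>x. norm (of_real ((\<theta> x)\<^sup>2) * K x) \<partial>M"
  have iI: "integrable M (\<lambda>x. cis (\<tau> * \<theta> x + \<beta> x) * K x)" for \<tau>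
    by (intro integrable_cis_mult K) auto
  have iD: "integrable M (\<lambda>x. cis (\<tau> * \<theta> x + \<beta> x) * (\<i> * of_real (\<theta> x) * K x))"
    using K(2) by (intro integrable_cis_mult) (auto simp: mult.assoc)
  show "norm (?I y - ?I \<tau> - (y - \<tau>) *\<^sub>R ?D) / norm (y - \<tau>) \<le> ?C * \<bar>y - \<tau>\<bar>" if "y \<noteq> \<tau>" for y
  proof -
    have "?I y - ?I \<tau> - (y - \<tau>) *\<^sub>R ?D =
      (\<integral>x. cis (y * \<theta> x + \<beta> x) * K x - cis (\<tau> * \<theta> x + \<beta> x) * K x
          - (y - \<tau>) *\<^sub>R (cis (\<tau> * \<theta> x + \<beta> x) * (\<i> * of_real (\<theta> x) * K x)) \<partial>M)"
      using iI iD by simp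
    also have "norm \<dots> \<le> (\<integral>x. (y - \<tau>)\<^sup>2 * norm (of_real ((\<theta> x)\<^sup>2) * K x) \<partial>M)"
    proof (rule order_trans[OF integral_norm_bound integral_mono])
      fix x
      have "cis (y * \<theta> x + \<beta> x) * K x - cis (\<tau> * \<theta> x + \<beta> x) * K x
          - (y - \<tau>) *\<^sub>R (cis (\<tau> * \<theta> x + \<beta> x) * (\<i> * of_real (\<theta> x) * K x))
        = (cis ((\<tau> * \<theta> x + \<beta> x) + (y - \<tau>) * \<theta> x) - cis (\<tau> * \<theta> x + \<beta> x)
            - \<i> * of_real ((y - \<tau>) * \<theta> x) * cis (\<tau> * \<theta> x + \<beta> x)) * K x"
        by (simp add: algebra_simps scaleR_conv_of_real)
      also have "norm \<dots> \<le> (((y - \<tau>) * \<theta> x)\<^sup>2 / 2) * norm (K x)"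
        unfolding norm_mult by (intro mult_right_mono norm_cis_taylor2) auto
      also have "\<dots> \<le> (y - \<tau>)\<^sup>2 * norm (of_real ((\<theta> x)\<^sup>2) * K x)"
        by (simp add: norm_mult power_mult_distrib norm_power)
      finally show "norm (cis (y * \<theta> x + \<beta> x) * K x - cis (\<tau> * \<theta> x + \<beta> x) * K x
          - (y - \<tau>) *\<^sub>R (cis (\<tau> * \<theta> x + \<beta> x) * (\<i> * of_real (\<theta> x) * K x))) \<le> \<dots>" .
    qed (use iI iD K(3) in auto)
    also have "\<dots> = ?C * (y - \<tau>)\<^sup>2" by simp
    finally show ?thesis
      using that by (simp add: divide_le_eq power2_eq_square mult.assoc)
  qed
  have "((\<lambda>y. ?C * \<bar>y - \<tau>\<bar>) \<longlongrightarrow> ?C * \<bar>\<tau> - \<tau>\<bar>) (at \<tau> within S)"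
    by (intro tendsto_intros)
  then show "((\<lambda>y. ?C * \<bar>y - \<tau>\<bar>) \<longlongrightarrow> 0) (at \<tau> within S)" by simp
qed (auto intro: bounded_linear_scaleR_left)

section \<open>The Fourier transform on Schwartz functions\<close>

text \<open>The sign \<open>c = -1\<close> gives the Fourier transform and \<open>c = 1\<close> the unnormalised inverse; one parameter
  lets both be treated by the same lemmas.\<close>

definition osc_integral :: "real \<Rightarrow> (real \<Rightarrow> complex) \<Rightarrow> real \<Rightarrow> complex" where
  "osc_integral c f \<xi> = (\<integral>x. cis (c * x * \<xi>) * f x \<partial>lborel)"

lemma fourier_eq_osc_integral: "fourier f = osc_integral (-1) f"
  by (simp add: fun_eq_iff fourier_def osc_integral_def)

lemma osc_integral_measurable [measurable]:
  assumes [measurable]: "f \<in> borel_measurable borel"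
  shows "osc_integral c f \<in> borel_measurable borel"
  unfolding osc_integral_def[abs_def] by measurable

lemma norm_osc_integral_le:
  assumes "integrable lborel f"
  shows "norm (osc_integral c f \<xi>) \<le> (\<integral>x. norm (f x) \<partial>lborel)"
  unfolding osc_integral_def
  by (rule order_trans[OF integral_norm_bound]) (simp add: norm_mult)

lemma osc_integral_has_vector_derivative:
  assumes "f \<in> schwartz"
  shows "(osc_integral c f has_vector_derivative osc_integral c (\<lambda>x. \<i> * of_real c * (of_real x * f x)) \<xi>) (at \<xi>)"
proof -
  have 1: "integrable lborel (\<lambda>x. of_real x * f x)"
    "integrable lborel (\<lambda>x. of_real x * (of_real x * f x))"
    using assms schwartz_mult_x schwartz_integrable by blast+
  have 2: "integrable lborel (\<lambda>x. of_real (c * x) * f x)"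
    "integrable lborel (\<lambda>x. of_real ((c * x)\<^sup>2) * f x)"
    using integrable_mult_right[OF 1(1), of "of_real c"]
      integrable_mult_right[OF 1(2), of "of_real (c\<^sup>2)"]
    by (simp_all add: algebra_simps power2_eq_square)
  have "((\<lambda>\<xi>. \<integral>x. cis (\<xi> * (c * x) + 0) * f x \<partial>lborel) has_vector_derivative
    (\<integral>x. cis (\<xi> * (c * x) + 0) * (\<i> * of_real (c * x) * f x) \<partial>lborel)) (at \<xi>)"
    by (rule has_vector_derivative_cis_integral) (use 2 schwartz_integrable[OF assms] in auto)
  then show ?thesis
    by (simp add: osc_integral_def[abs_def] mult_ac)
qed

lemma integral_derivative_eq_0:
  fixes F :: "real \<Rightarrow> complex"
  assumes "\<And>x. (F has_vector_derivative f x) (at x)" "continuous_on UNIV f" "integrable lborel f"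
    "(F \<longlongrightarrow> 0) at_top" "(F \<longlongrightarrow> 0) at_bot"
  shows "(\<integral>x. f x \<partial>lborel) = 0"
proof -
  have "(LBINT x=-\<infinity>..\<infinity>. f x) = 0 - 0"
  proof (rule interval_integral_FTC_integrable)
    show "((F \<circ> real_of_ereal) \<longlongrightarrow> 0) (at_right (-\<infinity>))"
      "((F \<circ> real_of_ereal) \<longlongrightarrow> 0) (at_left \<infinity>)"
      using assms(4,5) by (simp_all add: ereal_tendsto_simps)
  qed (use assms in \<open>auto simp: continuous_on_eq_continuous_at set_integrable_def\<close>)
  then show ?thesis
    by (simp add: interval_lebesgue_integral_def set_lebesgue_integral_def)
qed

text \<open>Integration by parts: the boundary terms vanish by the decay of \<open>f\<close>.\<close>

lemma osc_integral_vderiv: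
  assumes "f \<in> schwartz"
  shows "osc_integral c (vderiv f) \<xi> = - \<i> * of_real c * of_real \<xi> * osc_integral c f \<xi>"
proof -
  let ?e = "\<lambda>x. cis (c * x * \<xi>)"
  have f': "vderiv f \<in> schwartz" using schwartz_vderiv[OF assms] .
  have i1: "integrable lborel (\<lambda>x. ?e x * vderiv f x)"
    by (intro integrable_cis_mult schwartz_integrable f') auto
  have i2: "integrable lborel (\<lambda>x. \<i> * of_real (c * \<xi>) * (?e x * f x))"
    by (intro integrable_mult_right integrable_cis_mult schwartz_integrable assms) auto
  have e: "(?e has_vector_derivative \<i> * of_real (c * \<xi>) * ?e x) (at x)" for x
  proof -
    have "((\<lambda>z. exp (\<i> * of_real (c * \<xi>) * z)) has_field_derivative
        \<i> * of_real (c * \<xi>) * exp (\<i> * of_real (c * \<xi>) * of_real x)) (at (of_real x))"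
      by (auto intro!: derivative_eq_intros)
    from has_vector_derivative_real_field[OF this] show ?thesis
      by (simp add: cis_conv_exp mult_ac)
  qed
  have "(\<integral>x. ?e x * vderiv f x + \<i> * of_real (c * \<xi>) * (?e x * f x) \<partial>lborel) = 0"
  proof (rule integral_derivative_eq_0)
    show "((\<lambda>x. ?e x * f x) has_vector_derivative
        ?e x * vderiv f x + \<i> * of_real (c * \<xi>) * (?e x * f x)) (at x)" for x
      using has_vector_derivative_mult[OF e schwartz_vderiv_at[OF assms], of x] by (simp only: mult.assoc)
    show "continuous_on UNIV (\<lambda>x. ?e x * vderiv f x + \<i> * of_real (c * \<xi>) * (?e x * f x))"
      using schwartz_continuous[OF assms] schwartz_continuous[OF f'] by (intro continuous_intros)
    show "((\<lambda>x. ?e x * f x) \<longlongrightarrow> 0) at_top" "((\<lambda>x. ?e x * f x) \<longlongrightarrow> 0) at_bot"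
      by (rule Lim_null_comparison[OF _ tendsto_norm_zero[OF schwartz_at_infinity(1)[OF assms]]]
            Lim_null_comparison[OF _ tendsto_norm_zero[OF schwartz_at_infinity(2)[OF assms]]],
          simp add: norm_mult)+
  qed (use i1 i2 in simp)
  then show ?thesis
    using i1 i2 by (simp add: osc_integral_def algebra_simps eq_neg_iff_add_eq_0)
qed

text \<open>Up to constants, differentiation and multiplication by the variable on one side correspond to
  multiplication by the variable and differentiation on the other. Hence the set of all transforms
  of Schwartz functions satisfies the hypotheses of the coinduction rule.\<close>

lemma schwartz_osc_integral:
  assumes "c \<noteq> 0" "f \<in> schwartz"
  shows "osc_integral c f \<in> schwartz"
proof (rule schwartz_coinduct[of _ "osc_integral c ` schwartz"])
  fix g assume "g \<in> osc_integral c ` schwartz"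
  then obtain f where f: "f \<in> schwartz" and g: "g = osc_integral c f" by blast
  have "vderiv g = osc_integral c (\<lambda>x. \<i> * of_real c * (of_real x * f x))"
    unfolding g by (rule vderiv_eqI) (rule osc_integral_has_vector_derivative[OF f])
  moreover have "(\<lambda>x. of_real x * g x) = osc_integral c (\<lambda>x. (\<i> / of_real c) * vderiv f x)"
  proof
    fix x
    have "osc_integral c (\<lambda>x. (\<i> / of_real c) * vderiv f x) x = (\<i> / of_real c) * osc_integral c (vderiv f) x"
      unfolding osc_integral_def by (subst integral_mult_right_zero[symmetric]) (simp add: algebra_simps)
    then show "of_real x * g x = osc_integral c (\<lambda>x. (\<i> / of_real c) * vderiv f x) x"
      using assms(1) by (simp add: g osc_integral_vderiv[OF f])
  qed
  moreover have "bounded (range g)"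
    unfolding g bounded_iff using norm_osc_integral_le[OF schwartz_integrable[OF f]] by blast
  moreover have "g differentiable (at x)" for x
    unfolding g using osc_integral_has_vector_derivative[OF f] by (rule differentiableI_vector)
  ultimately show "(\<forall>x. g differentiable at x) \<and> vderiv g \<in> osc_integral c ` schwartz \<and>
      (\<lambda>x. complex_of_real x * g x) \<in> osc_integral c ` schwartz \<and> bounded (range g)"
    using f by (auto intro!: imageI schwartz_cmult schwartz_mult_x schwartz_vderiv
      simp del: times_divide_eq_left)
qed (use assms in auto)

section \<open>Fourier inversion\<close>

lemma integrable_pair_kernel:
  fixes K L :: "real \<Rightarrow> complex" and m :: "real \<Rightarrow> real \<Rightarrow> complex"
  assumes K: "integrable lborel K" and L: "integrable lborel L"
    and m: "(\<lambda>(x, y). m x y) \<in> borel_measurable (borel \<Otimes>\<^sub>M borel)"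
    and B: "\<And>x y. norm (m x y) \<le> B"
  shows "integrable (lborel \<Otimes>\<^sub>M lborel) (\<lambda>(x, y). m x y * K x * L y)"
proof (rule Bochner_Integration.integrable_bound)
  have [measurable]: "K \<in> borel_measurable borel" "L \<in> borel_measurable borel"
    using K L by auto
  have "integrable (lborel \<Otimes>\<^sub>M lborel) (\<lambda>(x, y). K x * L y)"
    using K L
    by (intro lborel_pair.Fubini_integrable) (auto simp: norm_mult integrable_norm)
  then show "integrable (lborel \<Otimes>\<^sub>M lborel) (\<lambda>z. of_real B * (case z of (x, y) \<Rightarrow> K x * L y))"
    by (rule integrable_mult_right)
  show "(\<lambda>(x, y). m x y * K x * L y) \<in> borel_measurable (lborel \<Otimes>\<^sub>M lborel)"
    using m by measurable
  have "0 \<le> B" using B norm_ge_zero order_trans by blast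
  then show "AE z in lborel \<Otimes>\<^sub>M lborel. norm (case z of (x, y) \<Rightarrow> m x y * K x * L y)
      \<le> norm (of_real B * (case z of (x, y) \<Rightarrow> K x * L y) :: complex)"
    by (auto simp: norm_mult mult.assoc split: prod.splits intro!: mult_right_mono B)
qed

text \<open>A bounded measurable kernel can be moved from one integrable factor to the other. Fourier duality,
  Gaussian regularisation and the exchange of the time integral with a frequency integral are all
  instances.\<close>

lemma Fubini_kernel:
  fixes K L :: "real \<Rightarrow> complex" and m :: "real \<Rightarrow> real \<Rightarrow> complex"
  assumes K: "integrable lborel K" and L: "integrable lborel L"
    and m: "(\<lambda>(x, y). m x y) \<in> borel_measurable (borel \<Otimes>\<^sub>M borel)"
    and B: "\<And>x y. norm (m x y) \<le> B"
  shows "(\<integral>y. (\<integral>x. m x y * K x \<partial>lborel) * L y \<partial>lborel)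
     = (\<integral>x. (\<integral>y. m x y * L y \<partial>lborel) * K x \<partial>lborel)"
proof -
  have "(\<integral>y. (\<integral>x. m x y * K x * L y \<partial>lborel) \<partial>lborel)
     = (\<integral>x. (\<integral>y. m x y * K x * L y \<partial>lborel) \<partial>lborel)"
    by (rule lborel_pair.Fubini_integral) (rule integrable_pair_kernel[OF assms])
  moreover have "(\<integral>y. m x y * K x * L y \<partial>lborel) = (\<integral>y. m x y * L y \<partial>lborel) * K x" for x
    by (subst integral_mult_left_zero[symmetric]) (simp add: mult_ac)
  ultimately show ?thesis by simp
qed

text \<open>Up to normalisation, this is the characteristic function of the standard
  normal distribution.\<close>

lemma gaussian_cis_integral:
  "(\<integral>x. cis (a * x) * of_real (exp (- x\<^sup>2 / 2)) \<partial>lborel) = of_real (sqrt (2 * pi) * exp (- a\<^sup>2 / 2))"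
proof -
  have "of_real (exp (- (a^2) / 2)) = (\<integral>x. iexp (a * x) \<partial>std_normal_distribution)"
    using char_std_normal_distribution by (simp add: char_def fun_eq_iff)
  also have "\<dots> = (\<integral>x. std_normal_density x *\<^sub>R iexp (a * x) \<partial>lborel)"
    by (subst integral_density) auto
  also have "\<dots> = (\<integral>x. of_real (1 / sqrt (2 * pi)) * (cis (a * x) * of_real (exp (- x\<^sup>2 / 2))) \<partial>lborel)"
    by (intro Bochner_Integration.integral_cong)
      (auto simp: std_normal_density_def cis_conv_exp scaleR_conv_of_real)
  also have "\<dots> = of_real (1 / sqrt (2 * pi)) * (\<integral>x. cis (a * x) * of_real (exp (- x\<^sup>2 / 2)) \<partial>lborel)"
    by (rule integral_mult_right_zero)
  finally show ?thesis by (simp add: field_simps)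
qed

lemma gaussian_integrable: "integrable lborel (\<lambda>x::real. exp (- x\<^sup>2 / 2))"
proof -
  have "integrable lborel std_normal_density" by simp
  then have "integrable lborel (\<lambda>x. sqrt (2 * pi) * std_normal_density x)" by (rule integrable_mult_right)
  then show ?thesis by (simp add: std_normal_density_def)
qed

lemma gaussian_scaled_integrable: "e \<noteq> 0 \<Longrightarrow> integrable lborel (\<lambda>x::real. exp (- (e * x)\<^sup>2 / 2))"
  using lborel_integrable_real_affine[OF gaussian_integrable, of e 0] by simp

lemma gaussian_scaled_cis_integral:
  assumes "e > 0"
  shows "(\<integral>x. cis (a * x) * of_real (exp (- (e * x)\<^sup>2 / 2)) \<partial>lborel)
     = of_real (sqrt (2 * pi) / e * exp (- (a / e)\<^sup>2 / 2))"
proof -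
  have "of_real (sqrt (2 * pi) * exp (- (a / e)\<^sup>2 / 2))
      = (\<integral>x. cis (a / e * x) * of_real (exp (- x\<^sup>2 / 2)) \<partial>lborel)"
    by (rule gaussian_cis_integral[symmetric])
  also have "\<dots> = \<bar>e\<bar> *\<^sub>R (\<integral>x. cis (a / e * (0 + e * x)) * of_real (exp (- (0 + e * x)\<^sup>2 / 2)) \<partial>lborel)"
    using assms by (intro lborel_integral_real_affine) auto
  finally show ?thesis
    using assms by (simp add: scaleR_conv_of_real field_simps)
qed

text \<open>Inserting the factor \<open>exp (- (\<epsilon> \<xi>)\<^sup>2 / 2)\<close> makes the double integral absolutely convergent. Exchanging
  the integrals turns the factor into a Gaussian average of \<open>f\<close> around \<open>x\<close> at scale \<open>\<epsilon>\<close>. As \<open>\<epsilon>\<close> tends to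
  \<open>0\<close>, dominated convergence applies on both sides, and the value is \<open>\<surd>(2\<pi>) \<cdot> \<surd>(2\<pi>) \<cdot> f x\<close>.\<close>

lemma osc_integral_inversion:
  assumes f: "f \<in> schwartz" and c: "c = 1 \<or> c = -1"
  shows "osc_integral (-c) (osc_integral c f) x = 2 * of_real pi * f x"
proof -
  define e where "e n = 1 / real (Suc n)" for n
  have e_pos: "e n > 0" for n by (simp add: e_def)
  have e_lim: "e \<longlonglongrightarrow> 0" unfolding e_def[abs_def] by (rule LIMSEQ_Suc[OF lim_1_over_n])
  let ?g = "\<lambda>n \<xi>. complex_of_real (exp (- (e n * \<xi>)\<^sup>2 / 2))"
  let ?L = "\<lambda>n \<xi>. cis (- c * \<xi> * x) * ?g n \<xi>"
  have Tf: "osc_integral c f \<in> schwartz" using c f schwartz_osc_integral by auto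
  have [measurable]: "f \<in> borel_measurable borel" "osc_integral c f \<in> borel_measurable borel"
    using schwartz_measurable[OF f] schwartz_measurable[OF Tf] by auto
  \<comment> \<open>The regularised inversion integral is a Gaussian average of \<open>f\<close> around \<open>x\<close>.\<close>
  have J: "(\<integral>\<xi>. osc_integral c f \<xi> * ?L n \<xi> \<partial>lborel)
     = of_real (sqrt (2 * pi)) * (\<integral>z. of_real (exp (- z\<^sup>2 / 2)) * f (x + e n * z) \<partial>lborel)" for n
  proof -
    \<comment> \<open>Only after the regularisation is the integrand integrable in both variables.\<close>
    have "(\<integral>\<xi>. osc_integral c f \<xi> * ?L n \<xi> \<partial>lborel) = (\<integral>y. (\<integral>\<xi>. cis (c * y * \<xi>) * ?L n \<xi> \<partial>lborel) * f y \<partial>lborel)"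
      unfolding osc_integral_def
    proof (rule Fubini_kernel[where B=1])
      show "integrable lborel (?L n)"
        using gaussian_scaled_integrable[of "e n"] e_pos[of n]
        by (intro integrable_cis_mult integrable_of_real) auto
    qed (use schwartz_integrable[OF f] in auto)
    also have "\<dots> = (\<integral>y. of_real (sqrt (2 * pi) / e n * exp (- (c * (y - x) / e n)\<^sup>2 / 2)) * f y \<partial>lborel)"
    proof (intro Bochner_Integration.integral_cong refl arg_cong2[of _ _ _ _ "(*)"])
      fix y
      have "cis (c * y * \<xi>) * ?L n \<xi> = cis (c * (y - x) * \<xi>) * ?g n \<xi>" for \<xi>
        by (simp add: mult.assoc[symmetric] cis_mult) (simp add: algebra_simps)
      then show "(\<integral>\<xi>. cis (c * y * \<xi>) * ?L n \<xi> \<partial>lborel)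
          = of_real (sqrt (2 * pi) / e n * exp (- (c * (y - x) / e n)\<^sup>2 / 2))"
        by (simp only: gaussian_scaled_cis_integral[OF e_pos])
    qed
    also have "\<dots> = \<bar>e n\<bar> *\<^sub>R (\<integral>z. of_real (sqrt (2 * pi) / e n
        * exp (- (c * ((x + e n * z) - x) / e n)\<^sup>2 / 2)) * f (x + e n * z) \<partial>lborel)"
      using e_pos[of n] by (intro lborel_integral_real_affine) auto
    also have "\<dots> = \<bar>e n\<bar> *\<^sub>R (\<integral>z. of_real (sqrt (2 * pi) / e n) *
        (of_real (exp (- z\<^sup>2 / 2)) * f (x + e n * z)) \<partial>lborel)"
      using e_pos[of n] c by (intro arg_cong2[of _ _ _ _ scaleR] Bochner_Integration.integral_cong refl) auto
    also have "\<dots> = of_real (sqrt (2 * pi)) * (\<integral>z. of_real (exp (- z\<^sup>2 / 2)) * f (x + e n * z) \<partial>lborel)"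
      unfolding integral_mult_right_zero using e_pos[of n] by (simp add: scaleR_conv_of_real)
    finally show ?thesis .
  qed
  have lim1: "(\<lambda>n. \<integral>\<xi>. osc_integral c f \<xi> * ?L n \<xi> \<partial>lborel) \<longlonglongrightarrow> (\<integral>\<xi>. osc_integral c f \<xi> * cis (- c * \<xi> * x) \<partial>lborel)"
  proof (rule integral_dominated_convergence)
    show "integrable lborel (\<lambda>\<xi>. norm (osc_integral c f \<xi>))" using schwartz_integrable[OF Tf] by simp
    have "(\<lambda>n. osc_integral c f \<xi> * ?L n \<xi>) \<longlonglongrightarrow> osc_integral c f \<xi> * (cis (- c * \<xi> * x) * of_real (exp (- (0 * \<xi>)\<^sup>2 / 2)))" for \<xi>
      by (intro tendsto_intros e_lim) auto
    then show "AE \<xi> in lborel. (\<lambda>n. osc_integral c f \<xi> * ?L n \<xi>) \<longlonglongrightarrow> osc_integral c f \<xi> * cis (- c * \<xi> * x)"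
      by simp
    show "AE \<xi> in lborel. norm (osc_integral c f \<xi> * ?L n \<xi>) \<le> norm (osc_integral c f \<xi>)" for n
      by (auto simp: norm_mult mult_left_le)
  qed auto
  have lim2: "(\<lambda>n. \<integral>z. of_real (exp (- z\<^sup>2 / 2)) * f (x + e n * z) \<partial>lborel)
      \<longlonglongrightarrow> (\<integral>z. of_real (exp (- z\<^sup>2 / 2)) * f x \<partial>lborel)"
  proof (rule integral_dominated_convergence)
    show "integrable lborel (\<lambda>z. schwartz_seminorm 0 0 f * exp (- z\<^sup>2 / 2))"
      using gaussian_integrable by simp
    have "isCont f x" using schwartz_continuous[OF f] by (simp add: continuous_on_eq_continuous_at)
    moreover have "(\<lambda>n. x + e n * z) \<longlonglongrightarrow> x" for z
      using tendsto_add[OF tendsto_const tendsto_mult_left_zero[OF e_lim, of z], of x] by simp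
    ultimately show "AE z in lborel. (\<lambda>n. of_real (exp (- z\<^sup>2 / 2)) * f (x + e n * z))
        \<longlonglongrightarrow> of_real (exp (- z\<^sup>2 / 2)) * f x"
      by (intro AE_I2 tendsto_mult tendsto_const isCont_tendsto_compose[of x f])
    show "AE z in lborel. norm (of_real (exp (- z\<^sup>2 / 2)) * f (x + e n * z))
        \<le> schwartz_seminorm 0 0 f * exp (- z\<^sup>2 / 2)" for n
      using schwartz_sup_bound[OF f] by (auto simp: norm_mult)
  qed auto
  have g: "(\<integral>z. complex_of_real (exp (- z\<^sup>2 / 2)) \<partial>lborel) = of_real (sqrt (2 * pi))"
    using gaussian_cis_integral[of 0] by simp
  have "(\<integral>z. of_real (exp (- z\<^sup>2 / 2)) * f x \<partial>lborel) = of_real (sqrt (2 * pi)) * f x"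
    unfolding integral_mult_left_zero g ..
  with lim2 have "(\<lambda>n. \<integral>\<xi>. osc_integral c f \<xi> * ?L n \<xi> \<partial>lborel)
      \<longlonglongrightarrow> of_real (sqrt (2 * pi)) * (of_real (sqrt (2 * pi)) * f x)"
    unfolding J by (intro tendsto_mult tendsto_const) (simp only:)
  with lim1 have "(\<integral>\<xi>. osc_integral c f \<xi> * cis (- c * \<xi> * x) \<partial>lborel)
      = of_real (sqrt (2 * pi)) * (of_real (sqrt (2 * pi)) * f x)"
    by (rule LIMSEQ_unique)
  also have "\<dots> = complex_of_real (sqrt (2 * pi) * sqrt (2 * pi)) * f x"
    by (simp only: of_real_mult mult.assoc)
  also have "\<dots> = 2 * of_real pi * f x" by simp
  finally show ?thesis
    unfolding osc_integral_def[of "-c"] by (simp only: mult.commute[of "osc_integral c f _"])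
qed

section \<open>Uniqueness of the Fourier density\<close>

text \<open>The positive and the negative part of \<open>k\<close> have the same mass \<open>m\<close> and the same Fourier transform.
  Divided by \<open>m\<close> they are densities of two probability measures with equal characteristic functions,
  and Levy's uniqueness theorem identifies them.\<close>

lemma AE_zero_if_char_zero_real:
  fixes k :: "real \<Rightarrow> real"
  assumes k: "integrable lborel k" and z: "\<And>t. (\<integral>x. cis (t * x) * of_real (k x) \<partial>lborel) = 0"
  shows "AE x in lborel. k x = 0"
proof -
  define p where "p = (\<lambda>x. max 0 (k x))"
  define q where "q = (\<lambda>x. max 0 (- k x))"
  have p: "integrable lborel p" and q: "integrable lborel q"
    unfolding p_def q_def using k by auto
  have [measurable]: "p \<in> borel_measurable borel" "q \<in> borel_measurable borel"
    using p q by auto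
  have kpq: "k x = p x - q x" and pos: "p x \<ge> 0" "q x \<ge> 0" for x
    by (auto simp: p_def q_def)
  have eq: "(\<integral>x. cis (t * x) * of_real (p x) \<partial>lborel) = (\<integral>x. cis (t * x) * of_real (q x) \<partial>lborel)" for t
  proof -
    have "integrable lborel (\<lambda>x. cis (t * x) * of_real (p x))"
      "integrable lborel (\<lambda>x. cis (t * x) * of_real (q x))"
      using p q by (auto intro!: integrable_cis_mult integrable_of_real)
    then show ?thesis
      using z[of t] by (simp add: kpq right_diff_distrib)
  qed
  define m where "m = integral\<^sup>L lborel p"
  have "complex_of_real (integral\<^sup>L lborel p) = of_real (integral\<^sup>L lborel q)"
    using eq[of 0] p q by simp
  then have mq: "m = integral\<^sup>L lborel q" by (simp only: m_def of_real_eq_iff)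
  show ?thesis
  proof (cases "m = 0")
    case True
    have "AE x in lborel. p x = 0" "AE x in lborel. q x = 0"
      using integral_nonneg_eq_0_iff_AE[OF p] integral_nonneg_eq_0_iff_AE[OF q] pos True mq m_def by auto
    then show ?thesis by eventually_elim (simp add: kpq)
  next
    case False
    have "m \<ge> 0" unfolding m_def using pos by (intro integral_nonneg_AE) auto
    with False have m: "m > 0" by simp
    have rd: "real_distribution (density lborel (\<lambda>x. ennreal (r x / m)))"
      if r: "integrable lborel r" "\<And>x. r x \<ge> 0" "integral\<^sup>L lborel r = m" for r :: "real \<Rightarrow> real"
    proof -
      have [measurable]: "r \<in> borel_measurable borel" using r by auto
      have "(\<integral>\<^sup>+ x. ennreal (r x / m) \<partial>lborel) = ennreal (\<integral>x. r x / m \<partial>lborel)"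
        using r m by (intro nn_integral_eq_integral) auto
      also have "\<dots> = 1" using r m by simp
      finally have "prob_space (density lborel (\<lambda>x. ennreal (r x / m)))"
        by (intro prob_spaceI) (simp add: emeasure_density)
      then show ?thesis
        by (simp add: real_distribution_def real_distribution_axioms_def)
    qed
    have ch: "char (density lborel (\<lambda>x. ennreal (r x / m))) t
        = (\<integral>x. cis (t * x) * of_real (r x) \<partial>lborel) / of_real m"
      if r: "integrable lborel r" "\<And>x. r x \<ge> 0" for r :: "real \<Rightarrow> real" and t
    proof -
      have [measurable]: "r \<in> borel_measurable borel" using r by auto
      have "char (density lborel (\<lambda>x. ennreal (r x / m))) t = (\<integral>x. (r x / m) *\<^sub>R iexp (t * x) \<partial>lborel)"
        unfolding char_def using r m by (subst integral_density) auto
      also have "\<dots> = (\<integral>x. cis (t * x) * of_real (r x) / of_real m \<partial>lborel)"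
        by (intro Bochner_Integration.integral_cong) (auto simp: cis_conv_exp scaleR_conv_of_real)
      also have "\<dots> = (\<integral>x. cis (t * x) * of_real (r x) \<partial>lborel) / of_real m"
        by (rule integral_divide_zero)
      finally show ?thesis .
    qed
    have "density lborel (\<lambda>x. ennreal (p x / m)) = density lborel (\<lambda>x. ennreal (q x / m))"
    proof (rule Levy_uniqueness)
      show "char (density lborel (\<lambda>x. ennreal (p x / m))) = char (density lborel (\<lambda>x. ennreal (q x / m)))"
        using ch[OF p pos(1)] ch[OF q pos(2)] eq by (simp add: fun_eq_iff)
    qed (use rd p q pos m_def mq in auto)
    then have "AE x in lborel. ennreal (p x / m) = ennreal (q x / m)"
      by (intro sigma_finite_measure.density_unique sigma_finite_lborel) auto
    then show ?thesis
      by eventually_elim (use pos m in \<open>simp add: kpq\<close>)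
  qed
qed

lemma AE_zero_if_char_zero:
  fixes h :: "real \<Rightarrow> complex"
  assumes h: "integrable lborel h" and z: "\<And>t. (\<integral>x. cis (t * x) * h x \<partial>lborel) = 0"
  shows "AE x in lborel. h x = 0"
proof -
  have i: "integrable lborel (\<lambda>x. cis (t * x) * h x)" for t
    using h by (intro integrable_cis_mult) auto
  have ic: "integrable lborel (\<lambda>x. cis (t * x) * cnj (h x))" for t
    using h by (intro integrable_cis_mult) auto
  have zc: "(\<integral>x. cis (t * x) * cnj (h x) \<partial>lborel) = 0" for t
  proof -
    have "(\<integral>x. cis (t * x) * cnj (h x) \<partial>lborel) = (\<integral>x. cnj (cis (- t * x) * h x) \<partial>lborel)"
      by (simp add: cis_cnj)
    also have "\<dots> = cnj (\<integral>x. cis (- t * x) * h x \<partial>lborel)" by (rule Bochner_Integration.integral_cnj)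
    also have "\<dots> = 0" by (simp only: z complex_cnj_zero)
    finally show ?thesis .
  qed
  have "AE x in lborel. Re (h x) = 0"
  proof (rule AE_zero_if_char_zero_real)
    fix t
    have "(\<integral>x. cis (t * x) * of_real (Re (h x)) \<partial>lborel)
        = (\<integral>x. (cis (t * x) * h x + cis (t * x) * cnj (h x)) / 2 \<partial>lborel)"
      by (intro Bochner_Integration.integral_cong refl)
        (simp add: distrib_left[symmetric] complex_add_cnj)
    also have "\<dots> = 0"
      using i ic z zc by (subst integral_divide_zero) simp
    finally show "(\<integral>x. cis (t * x) * of_real (Re (h x)) \<partial>lborel) = 0" .
  qed (use h in simp)
  moreover have "AE x in lborel. Im (h x) = 0"
  proof (rule AE_zero_if_char_zero_real)
    fix t
    have "(\<integral>x. cis (t * x) * of_real (Im (h x)) \<partial>lborel)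
        = (\<integral>x. (cis (t * x) * h x - cis (t * x) * cnj (h x)) / (2 * \<i>) \<partial>lborel)"
    proof (intro Bochner_Integration.integral_cong refl)
      fix x
      have "cis (t * x) * h x - cis (t * x) * cnj (h x) = 2 * \<i> * (cis (t * x) * of_real (Im (h x)))"
        by (simp add: right_diff_distrib[symmetric] complex_diff_cnj)
      then show "cis (t * x) * of_real (Im (h x)) = (cis (t * x) * h x - cis (t * x) * cnj (h x)) / (2 * \<i>)"
        by simp
    qed
    also have "\<dots> = 0"
      using i ic z zc by (subst integral_divide_zero) simp
    finally show "(\<integral>x. cis (t * x) * of_real (Im (h x)) \<partial>lborel) = 0" .
  qed (use h in simp)
  ultimately show ?thesis
    by eventually_elim (simp add: complex_eq_iff)
qed

lemma power_le_fact_exp: "0 \<le> y \<Longrightarrow> y ^ n \<le> fact n * exp (y :: real)"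
proof -
  assume y: "0 \<le> y"
  have "(\<Sum>i\<in>{n}. y ^ i /\<^sub>R fact i) \<le> exp y"
    unfolding exp_def using y by (intro sum_le_suminf summable_exp_generic) auto
  then show ?thesis by (simp add: field_simps)
qed

text \<open>With \<open>y = x\<^sup>2 / 2\<close> one has \<open>\<bar>x\<bar>\<^sup>n \<le> 1 + x\<^sup>2\<^sup>n = 1 + 2\<^sup>n y\<^sup>n\<close>, and \<open>y\<^sup>n / n!\<close> is one term of the exponential
  series of \<open>y\<close>.\<close>

lemma power_gaussian_bound: "\<bar>x\<bar> ^ n * exp (- x\<^sup>2 / 2) \<le> 1 + 2 ^ n * fact (n :: nat)" for x :: real
proof -
  have "\<bar>x\<bar> ^ n \<le> 1 + (x\<^sup>2) ^ n"
  proof (cases "\<bar>x\<bar> \<le> 1")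
    case True
    then show ?thesis using power_le_one[of "\<bar>x\<bar>" n] by (simp add: add_increasing2)
  next
    case False
    then have "\<bar>x\<bar> ^ n \<le> \<bar>x\<bar> ^ (2 * n)" by (intro power_increasing) auto
    then show ?thesis by (simp add: power_mult)
  qed
  also have "(x\<^sup>2) ^ n = 2 ^ n * (x\<^sup>2 / 2) ^ n" by (simp add: power_divide)
  also have "\<dots> \<le> 2 ^ n * (fact n * exp (x\<^sup>2 / 2))"
    by (intro mult_left_mono power_le_fact_exp) auto
  finally have "\<bar>x\<bar> ^ n * exp (- x\<^sup>2 / 2) \<le> (1 + 2 ^ n * (fact n * exp (x\<^sup>2 / 2))) * exp (- x\<^sup>2 / 2)"
    by (intro mult_right_mono) auto
  also have "\<dots> = exp (- x\<^sup>2 / 2) + 2 ^ n * fact n"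
    by (simp add: algebra_simps exp_minus field_simps)
  also have "\<dots> \<le> 1 + 2 ^ n * fact n" by simp
  finally show ?thesis .
qed

text \<open>Polynomials times a modulated Gaussian form a class to which the coinduction rule applies. The
  modulated Gaussians themselves are rich enough as test functions to separate densities.\<close>

lemma modulated_gaussian_schwartz:
  "(\<lambda>x. cis (t * x) * of_real (exp (- x\<^sup>2 / 2))) \<in> schwartz"
proof (rule schwartz_coinduct)
  let ?G = "\<lambda>x. cis (t * x) * complex_of_real (exp (- x\<^sup>2 / 2))"
  let ?Q = "range (\<lambda>p x. poly p (complex_of_real x) * ?G x)"
  show "?G \<in> ?Q" by (rule range_eqI[of _ _ 1]) simp
  fix f assume "f \<in> ?Q"
  then obtain p where f: "f = (\<lambda>x. poly p (complex_of_real x) * ?G x)" by auto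
  have G: "?G x = exp (\<i> * of_real t * of_real x - (of_real x)\<^sup>2 / 2)" for x
    by (auto simp: cis_conv_exp exp_of_real[symmetric] exp_add[symmetric] algebra_simps)
  have D: "(f has_vector_derivative poly (pderiv p + p * [:\<i> * of_real t, -1:]) (of_real x) * ?G x) (at x)" for x
  proof -
    let ?E = "\<lambda>z. exp (\<i> * of_real t * z - z\<^sup>2 / 2)"
    have "((\<lambda>z. poly p z * ?E z) has_field_derivative
        poly (pderiv p + p * [:\<i> * of_real t, -1:]) (of_real x) * ?E (of_real x)) (at (of_real x))"
      by (auto intro!: derivative_eq_intros poly_DERIV simp: algebra_simps)
    from has_vector_derivative_real_field[OF this] show ?thesis
      unfolding f G .
  qed
  have "vderiv f \<in> ?Q" unfolding vderiv_eqI[OF D] by (rule rangeI)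
  moreover have "(\<lambda>x. of_real x * f x) \<in> ?Q"
    unfolding f by (rule range_eqI[of _ _ "pCons 0 p"]) (simp add: mult_ac)
  moreover have "bounded (range f)"
    unfolding bounded_iff
  proof (intro exI[of _ "\<Sum>i\<le>degree p. norm (coeff p i) * (1 + 2 ^ i * fact i)"] ballI)
    fix y assume "y \<in> range f"
    then obtain x where y: "y = f x" by auto
    have "norm (f x) = norm (\<Sum>i\<le>degree p. coeff p i * of_real x ^ i) * exp (- x\<^sup>2 / 2)"
      by (simp add: f poly_altdef norm_mult)
    also have "\<dots> \<le> (\<Sum>i\<le>degree p. norm (coeff p i * of_real x ^ i)) * exp (- x\<^sup>2 / 2)"
      by (intro mult_right_mono norm_sum) simp
    also have "\<dots> \<le> (\<Sum>i\<le>degree p. norm (coeff p i) * (1 + 2 ^ i * fact i))"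
      unfolding sum_distrib_right
      using power_gaussian_bound[of x]
      by (intro sum_mono) (simp add: norm_mult norm_power mult.assoc mult_left_mono)
    finally show "norm y \<le> (\<Sum>i\<le>degree p. norm (coeff p i) * (1 + 2 ^ i * fact i))" by (simp add: y)
  qed
  moreover have "f differentiable (at x)" for x using D by (rule differentiableI_vector)
  ultimately show "(\<forall>x. f differentiable at x) \<and> vderiv f \<in> ?Q \<and>
      (\<lambda>x. complex_of_real x * f x) \<in> ?Q \<and> bounded (range f)"
    by blast
qed

text \<open>Pairing \<open>g - h\<close> with all modulations of one Gaussian shows that the integrable function
  \<open>(g - h) exp (- x\<^sup>2 / 2)\<close> has vanishing Fourier transform. Consequently the choice in
  \<^const>\<open>fourier_fun\<close> is determined up to a null set.\<close>

lemma regular_dist_unique: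
  assumes g: "tempered_fun g" and h: "tempered_fun h" and eq: "regular_dist g = regular_dist h"
  shows "AE x in lborel. g x = h x"
proof -
  let ?G = "\<lambda>t x. cis (t * x) * complex_of_real (exp (- x\<^sup>2 / 2))"
  have i: "integrable lborel (\<lambda>x. g x * ?G t x)" "integrable lborel (\<lambda>x. h x * ?G t x)" for t
    using g h modulated_gaussian_schwartz by (auto simp: tempered_fun_def)
  have "AE x in lborel. (g x - h x) * of_real (exp (- x\<^sup>2 / 2)) = 0"
  proof (rule AE_zero_if_char_zero)
    show "integrable lborel (\<lambda>x. (g x - h x) * complex_of_real (exp (- x\<^sup>2 / 2)))"
      using Bochner_Integration.integrable_diff[OF i[of 0]] by (simp add: left_diff_distrib)
    fix t
    have "(\<integral>x. g x * ?G t x \<partial>lborel) = (\<integral>x. h x * ?G t x \<partial>lborel)"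
      using fun_cong[OF eq, of "?G t"] modulated_gaussian_schwartz[of t] by (simp add: regular_dist_def)
    then have "(\<integral>x. g x * ?G t x - h x * ?G t x \<partial>lborel) = 0"
      using i[of t] by simp
    then show "(\<integral>x. cis (t * x) * ((g x - h x) * of_real (exp (- x\<^sup>2 / 2))) \<partial>lborel) = 0"
      by (simp add: algebra_simps)
  qed
  then show ?thesis by eventually_elim simp
qed

section \<open>Distributions with an integrable Fourier transform\<close>

definition inv_fourier :: "(real \<Rightarrow> complex) \<Rightarrow> real \<Rightarrow> complex" where
  "inv_fourier G x = osc_integral 1 G x / (2 * of_real pi)"

lemma schwartz_fourier: "f \<in> schwartz \<Longrightarrow> fourier f \<in> schwartz"
  unfolding fourier_eq_osc_integral by (rule schwartz_osc_integral) auto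

lemma schwartz_inv_fourier: "f \<in> schwartz \<Longrightarrow> inv_fourier f \<in> schwartz"
  using schwartz_cmult[OF schwartz_osc_integral[of 1 f], of "1 / (2 * of_real pi)"]
  by (simp add: inv_fourier_def[abs_def])

lemma inv_fourier_fourier: "f \<in> schwartz \<Longrightarrow> inv_fourier (fourier f) = f"
  using osc_integral_inversion[of f "-1"] by (auto simp: inv_fourier_def fourier_eq_osc_integral)

lemma fourier_inv_fourier:
  assumes "f \<in> schwartz"
  shows "fourier (inv_fourier f) = f"
proof
  fix x
  have "osc_integral (-1) (inv_fourier f) x = (\<integral>y. cis (-1 * y * x) * osc_integral 1 f y / (2 * of_real pi) \<partial>lborel)"
    by (simp add: osc_integral_def[of "-1"] inv_fourier_def)
  also have "\<dots> = osc_integral (-1) (osc_integral 1 f) x / (2 * of_real pi)"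
    unfolding osc_integral_def[of "-1"] by (rule integral_divide_zero)
  finally show "fourier (inv_fourier f) x = f x"
    using osc_integral_inversion[OF assms, of 1] by (simp add: fourier_eq_osc_integral)
qed

lemma inv_fourier_measurable [measurable]:
  assumes [measurable]: "G \<in> borel_measurable borel"
  shows "inv_fourier G \<in> borel_measurable borel"
  unfolding inv_fourier_def[abs_def] by measurable

lemma norm_inv_fourier_le:
  assumes "integrable lborel G"
  shows "norm (inv_fourier G x) \<le> (\<integral>\<xi>. norm (G \<xi>) \<partial>lborel)"
proof -
  have "norm (inv_fourier G x) = norm (osc_integral 1 G x) / (2 * pi)"
    by (simp add: inv_fourier_def norm_divide norm_mult)
  also have "\<dots> \<le> norm (osc_integral 1 G x) / 1"
    using pi_gt3 by (intro divide_left_mono) auto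
  finally show ?thesis using norm_osc_integral_le[OF assms, of 1 x] by simp
qed

lemma tempered_fun_integrable:
  assumes "integrable lborel G"
  shows "tempered_fun G"
  unfolding tempered_fun_def
proof (intro conjI ballI)
  have [measurable]: "G \<in> borel_measurable borel" using assms by auto
  show "G \<in> borel_measurable lborel" by simp
  fix f assume f: "f \<in> schwartz"
  then have [measurable]: "f \<in> borel_measurable borel" by (rule schwartz_measurable)
  show "integrable lborel (\<lambda>x. G x * f x)"
  proof (rule Bochner_Integration.integrable_bound)
    show "integrable lborel (\<lambda>x. of_real (schwartz_seminorm 0 0 f) * G x)"
      using assms by (intro integrable_mult_right)
    show "AE x in lborel. norm (G x * f x) \<le> norm (of_real (schwartz_seminorm 0 0 f) * G x)"
      using schwartz_sup_bound[OF f] schwartz_seminorm_nonneg[OF f]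
      by (auto simp: norm_mult mult.commute[of "norm (G _)"] intro!: mult_right_mono)
  qed simp
qed

lemma tempered_fun_bounded:
  assumes [measurable]: "U \<in> borel_measurable borel" and B: "\<And>x. norm (U x) \<le> B"
  shows "tempered_fun U"
  unfolding tempered_fun_def
proof (intro conjI ballI)
  show "U \<in> borel_measurable lborel" by simp
  fix f assume f: "f \<in> schwartz"
  then have [measurable]: "f \<in> borel_measurable borel" by (rule schwartz_measurable)
  show "integrable lborel (\<lambda>x. U x * f x)"
  proof (rule Bochner_Integration.integrable_bound)
    show "integrable lborel (\<lambda>x. of_real B * f x)"
      using schwartz_integrable[OF f] by (intro integrable_mult_right)
    have "norm (U x) \<le> \<bar>B\<bar>" for x using B[of x] by linarith
    then show "AE x in lborel. norm (U x * f x) \<le> norm (of_real B * f x)"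
      by (auto simp: norm_mult intro!: mult_right_mono)
  qed simp
qed

text \<open>The \<open>L\<^sup>1\<close> norm of a test function is at most \<open>\<pi>\<close> times the sum of its \<open>(0,0)\<close> and \<open>(2,0)\<close> seminorms.\<close>

lemma regular_dist_bounded_tempered:
  assumes [measurable]: "U \<in> borel_measurable borel" and B: "\<And>x. norm (U x) \<le> B"
  shows "regular_dist U \<in> tempered"
proof -
  have i: "integrable lborel (\<lambda>x. U x * f x)" if "f \<in> schwartz" for f
    using tempered_fun_bounded[OF assms] that by (simp add: tempered_fun_def)
  have "0 \<le> B" using B norm_ge_zero order_trans by blast
  have bound: "norm (regular_dist U f) \<le> B * pi * (\<Sum>j\<le>2. \<Sum>k\<le>2. schwartz_seminorm j k f)"
    if f: "f \<in> schwartz" for f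
  proof -
    have "norm (regular_dist U f) \<le> (\<integral>x. B * norm (f x) \<partial>lborel)"
      using f unfolding regular_dist_def
      by (simp only: if_True, intro order_trans[OF integral_norm_bound integral_mono])
        (use i[OF f, THEN integrable_norm] in
          \<open>auto simp: norm_mult i schwartz_integrable intro!: mult_right_mono B\<close>)
    also have "\<dots> \<le> B * (pi * (schwartz_seminorm 0 0 f + schwartz_seminorm 2 0 f))"
      using schwartz_L1_bound[OF f] \<open>0 \<le> B\<close> by (simp add: mult_left_mono)
    also have "\<dots> \<le> B * (pi * (\<Sum>j\<le>2. \<Sum>k\<le>2. schwartz_seminorm j k f))"
      using schwartz_seminorm_nonneg[OF f] \<open>0 \<le> B\<close>
      by (intro mult_left_mono) (auto simp: numeral_2_eq_2 add_nonneg_nonneg)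
    finally show ?thesis by (simp add: mult.assoc)
  qed
  have add: "regular_dist U (\<lambda>x. f x + g x) = regular_dist U f + regular_dist U g"
    if "f \<in> schwartz" "g \<in> schwartz" for f g
    using that schwartz_add[of f g] i by (simp add: regular_dist_def distrib_left)
  have cmult: "regular_dist U (\<lambda>x. a * f x) = a * regular_dist U f" if "f \<in> schwartz" for a f
    using that schwartz_cmult[of f a] by (simp add: regular_dist_def mult.left_commute)
  show ?thesis
    unfolding tempered_def mem_Collect_eq
    using bound add cmult by (auto simp: regular_dist_def[of U])
qed

text \<open>For integrable \<open>G\<close> this is the tempered distribution, in fact a bounded function, with Fourier
  transform \<open>G\<close>.\<close>

definition inv_fourier_dist :: "(real \<Rightarrow> complex) \<Rightarrow> functional" where
  "inv_fourier_dist G = regular_dist (inv_fourier G)"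

lemma inv_fourier_dist_pairing:
  assumes G: "integrable lborel G" and f: "f \<in> schwartz"
  shows "inv_fourier_dist G f = (\<integral>\<xi>. G \<xi> * inv_fourier f \<xi> \<partial>lborel)"
proof -
  have "(\<integral>x. (\<integral>\<xi>. cis (1 * \<xi> * x) * G \<xi> \<partial>lborel) * f x \<partial>lborel)
      = (\<integral>\<xi>. (\<integral>x. cis (1 * \<xi> * x) * f x \<partial>lborel) * G \<xi> \<partial>lborel)"
    by (rule Fubini_kernel[where B=1]) (use G schwartz_integrable[OF f] in auto)
  then have "(\<integral>x. osc_integral 1 G x * f x / (2 * of_real pi) \<partial>lborel)
      = (\<integral>\<xi>. G \<xi> * osc_integral 1 f \<xi> / (2 * of_real pi) \<partial>lborel)"
    unfolding integral_divide_zero by (simp add: osc_integral_def mult_ac)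
  then show ?thesis
    using f by (simp add: inv_fourier_dist_def regular_dist_def inv_fourier_def)
qed

lemma inv_fourier_dist_tempered:
  assumes "integrable lborel G"
  shows "inv_fourier_dist G \<in> tempered"
  unfolding inv_fourier_dist_def
  by (rule regular_dist_bounded_tempered[OF _ norm_inv_fourier_le[OF assms]]) (use assms in auto)

lemma has_fourier_inv_fourier_dist:
  assumes "integrable lborel G"
  shows "has_fourier (inv_fourier_dist G) G"
  using assms
  by (auto simp: has_fourier_def tempered_fun_integrable dist_fourier_def regular_dist_def fun_eq_iff
      inv_fourier_dist_pairing schwartz_fourier inv_fourier_fourier)

text \<open>Every Schwartz function is a Fourier transform of a Schwartz function, so the Fourier transform of
  a tempered distribution determines its value on each test function.\<close>

lemma has_fourier_imp_eq_inv_fourier_dist: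
  assumes G: "integrable lborel G" and w: "w \<in> tempered" and h: "has_fourier w G"
  shows "w = inv_fourier_dist G"
proof
  fix f
  show "w f = inv_fourier_dist G f"
  proof (cases "f \<in> schwartz")
    case True
    have "dist_fourier w (inv_fourier f) = regular_dist G (inv_fourier f)"
      using h by (simp add: has_fourier_def)
    then show ?thesis
      using True G
      by (simp add: dist_fourier_def regular_dist_def schwartz_inv_fourier fourier_inv_fourier
          inv_fourier_dist_pairing)
  next
    case False
    then show ?thesis using w by (simp add: tempered_def inv_fourier_dist_def regular_dist_def)
  qed
qed

lemma has_fourier_fourier_fun: "has_fourier u g \<Longrightarrow> has_fourier u (fourier_fun u)"
  unfolding fourier_fun_def by (rule someI[where P = "has_fourier u"])

lemma fourier_fun_AE:
  assumes "has_fourier u g"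
  shows "AE \<xi> in lborel. fourier_fun u \<xi> = g \<xi>"
  using regular_dist_unique[of "fourier_fun u" g] assms has_fourier_fourier_fun[OF assms]
  by (simp add: has_fourier_def)

lemma fourier_fun_measurable:
  assumes "has_fourier u g"
  shows "fourier_fun u \<in> borel_measurable borel"
  using has_fourier_fourier_fun[OF assms] by (simp add: has_fourier_def tempered_fun_def)

lemma has_fourier_cong_AE:
  assumes "AE \<xi> in lborel. g \<xi> = h \<xi>" "g \<in> borel_measurable borel" "h \<in> borel_measurable borel"
  shows "has_fourier w g \<longleftrightarrow> has_fourier w h"
proof -
  have *: "integrable lborel (\<lambda>x. g x * f x) \<longleftrightarrow> integrable lborel (\<lambda>x. h x * f x)"
      "(\<integral>x. g x * f x \<partial>lborel) = (\<integral>x. h x * f x \<partial>lborel)" if "f \<in> schwartz" for f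
  proof -
    have [measurable]: "f \<in> borel_measurable borel" "g \<in> borel_measurable borel" "h \<in> borel_measurable borel"
      using that schwartz_measurable assms by auto
    have "AE x in lborel. g x * f x = h x * f x" using assms(1) by eventually_elim simp
    then show "integrable lborel (\<lambda>x. g x * f x) \<longleftrightarrow> integrable lborel (\<lambda>x. h x * f x)"
      "(\<integral>x. g x * f x \<partial>lborel) = (\<integral>x. h x * f x \<partial>lborel)"
      by (intro integrable_cong_AE integral_cong_AE; simp)+
  qed
  have "tempered_fun g \<longleftrightarrow> tempered_fun h"
    unfolding tempered_fun_def using assms(2,3) by (intro conj_cong ball_cong *(1)) auto
  moreover have "regular_dist g = regular_dist h"
    unfolding regular_dist_def by (intro ext if_cong *(2)) auto
  ultimately show ?thesis by (simp add: has_fourier_def)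
qed

text \<open>The definite description in \<^const>\<open>fourier_mult\<close> refers to the chosen density \<^const>\<open>fourier_fun\<close>; it may be
  replaced by any known density, because the two agree almost everywhere.\<close>

lemma fourier_mult_eq:
  assumes h: "has_fourier u g" and [measurable]: "m \<in> borel_measurable borel"
    and i: "integrable lborel (\<lambda>\<xi>. m \<xi> * g \<xi>)"
  shows "fourier_mult m u = inv_fourier_dist (\<lambda>\<xi>. m \<xi> * g \<xi>)"
proof -
  have [measurable]: "fourier_fun u \<in> borel_measurable borel" "g \<in> borel_measurable borel"
    using fourier_fun_measurable[OF h] h by (auto simp: has_fourier_def tempered_fun_def)
  have "AE \<xi> in lborel. m \<xi> * fourier_fun u \<xi> = m \<xi> * g \<xi>"
    using fourier_fun_AE[OF h] by eventually_elim simp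
  then have "has_fourier w (\<lambda>\<xi>. m \<xi> * fourier_fun u \<xi>) \<longleftrightarrow> has_fourier w (\<lambda>\<xi>. m \<xi> * g \<xi>)" for w
    by (rule has_fourier_cong_AE) auto
  then have "fourier_mult m u = (THE w. w \<in> tempered \<and> has_fourier w (\<lambda>\<xi>. m \<xi> * g \<xi>))"
    by (simp add: fourier_mult_def)
  also have "\<dots> = inv_fourier_dist (\<lambda>\<xi>. m \<xi> * g \<xi>)"
    by (rule the_equality, intro conjI inv_fourier_dist_tempered has_fourier_inv_fourier_dist i,
      blast intro: has_fourier_imp_eq_inv_fourier_dist[OF i])
  finally show ?thesis .
qed

text \<open>By duality: the derivative of \<open>fourier f\<close> is the Fourier transform of \<open>- \<i> x f x\<close>.\<close>

lemma has_fourier_dist_deriv: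
  assumes h: "has_fourier u g"
  shows "has_fourier (dist_deriv u) (\<lambda>\<xi>. \<i> * of_real \<xi> * g \<xi>)"
  unfolding has_fourier_def
proof (intro conjI)
  have tg: "tempered_fun g" and eq: "dist_fourier u = regular_dist g"
    using h by (auto simp: has_fourier_def)
  have xs: "(\<lambda>x. \<i> * of_real c * (of_real x * f x)) \<in> schwartz" if "f \<in> schwartz" for f and c :: real
    using that by (intro schwartz_cmult schwartz_mult_x)
  show "tempered_fun (\<lambda>\<xi>. \<i> * of_real \<xi> * g \<xi>)"
    unfolding tempered_fun_def
  proof (intro conjI ballI)
    have [measurable]: "g \<in> borel_measurable borel" using tg by (simp add: tempered_fun_def)
    show "(\<lambda>\<xi>. \<i> * of_real \<xi> * g \<xi>) \<in> borel_measurable lborel" by simp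
    fix f assume "f \<in> schwartz"
    from xs[OF this, of 1] tg have "integrable lborel (\<lambda>x. g x * (\<i> * of_real 1 * (of_real x * f x)))"
      unfolding tempered_fun_def by (elim conjE) (erule bspec)
    then show "integrable lborel (\<lambda>x. \<i> * of_real x * g x * f x)" by (simp add: mult_ac)
  qed
  show "dist_fourier (dist_deriv u) = regular_dist (\<lambda>\<xi>. \<i> * of_real \<xi> * g \<xi>)"
  proof
    fix f
    show "dist_fourier (dist_deriv u) f = regular_dist (\<lambda>\<xi>. \<i> * of_real \<xi> * g \<xi>) f"
    proof (cases "f \<in> schwartz")
      case True
      let ?xf = "\<lambda>x. \<i> * of_real (-1) * (of_real x * f x)"
      have "vderiv (fourier f) = fourier ?xf"
        unfolding fourier_eq_osc_integral by (rule vderiv_eqI) (rule osc_integral_has_vector_derivative[OF True])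
      then have "dist_fourier (dist_deriv u) f = - dist_fourier u ?xf"
        using True xs[OF True, of "-1"] by (simp add: dist_fourier_def dist_deriv_def schwartz_fourier)
      also have "\<dots> = - (\<integral>x. g x * ?xf x \<partial>lborel)"
        using xs[OF True, of "-1"] unfolding eq by (simp add: regular_dist_def)
      also have "\<dots> = (\<integral>x. - (g x * ?xf x) \<partial>lborel)" by (rule integral_minus[symmetric])
      finally show ?thesis using True by (simp add: regular_dist_def mult_ac)
    qed (auto simp: dist_fourier_def regular_dist_def)
  qed
qed

lemma sobolev_norm_eq:
  assumes h: "has_fourier u g"
  shows "sobolev_norm s u = sqrt (\<integral>\<xi>. (bracket \<xi> powr s * norm (g \<xi>))\<^sup>2 \<partial>lborel)"
proof -
  have [measurable]: "fourier_fun u \<in> borel_measurable borel" "g \<in> borel_measurable borel"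
    using fourier_fun_measurable[OF h] h by (auto simp: has_fourier_def tempered_fun_def)
  have "(\<integral>\<xi>. (bracket \<xi> powr s * norm (fourier_fun u \<xi>))\<^sup>2 \<partial>lborel)
      = (\<integral>\<xi>. (bracket \<xi> powr s * norm (g \<xi>))\<^sup>2 \<partial>lborel)"
    using fourier_fun_AE[OF h] unfolding bracket_def
    by (intro integral_cong_AE) auto
  then show ?thesis by (simp add: sobolev_norm_def)
qed

section \<open>Products and convolution\<close>

definition conv :: "(real \<Rightarrow> complex) \<Rightarrow> (real \<Rightarrow> complex) \<Rightarrow> real \<Rightarrow> complex" where
  "conv G H \<zeta> = (\<integral>\<xi>. G \<xi> * H (\<zeta> - \<xi>) \<partial>lborel)"

lemma integral_shift:
  fixes H :: "real \<Rightarrow> 'a :: {banach, second_countable_topology}"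
  shows "(\<integral>\<zeta>. H (\<zeta> - \<xi>) \<partial>lborel) = integral\<^sup>L lborel H"
  using lborel_integral_real_affine[of 1 H "-\<xi>"] by simp

text \<open>Integrating the modulus over \<open>\<zeta>\<close> first gives \<open>\<bar>G \<xi>\<bar>\<close> times the \<open>L\<^sup>1\<close> norm of \<open>H\<close>.\<close>

lemma integrable_conv_pair:
  fixes G H :: "real \<Rightarrow> complex"
  assumes G: "integrable lborel G" and H: "integrable lborel H"
  shows "integrable (lborel \<Otimes>\<^sub>M lborel) (\<lambda>(\<xi>, \<zeta>). G \<xi> * H (\<zeta> - \<xi>))"
proof -
  have [measurable]: "G \<in> borel_measurable borel" "H \<in> borel_measurable borel"
    using G H by auto
  have Hs: "integrable lborel (\<lambda>\<zeta>. H (\<zeta> - \<xi>))" for \<xi>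
    using lborel_integrable_real_affine[OF H, of 1 "-\<xi>"] by simp
  have n: "(\<integral>\<zeta>. norm (H (\<zeta> - \<xi>)) \<partial>lborel) = (\<integral>\<zeta>. norm (H \<zeta>) \<partial>lborel)" for \<xi>
    by (rule integral_shift)
  show ?thesis
    using G Hs by (intro lborel_pair.Fubini_integrable) (auto simp: norm_mult n)
qed

lemma conv_integrable:
  assumes G: "integrable lborel G" and H: "integrable lborel H"
  shows "integrable lborel (conv G H)"
  using lborel_pair.integrable_snd[OF integrable_conv_pair[OF assms]]
  by (simp add: conv_def[abs_def])

lemma osc_integral_conv:
  assumes G: "integrable lborel G" and H: "integrable lborel H"
  shows "osc_integral 1 (conv G H) x = osc_integral 1 G x * osc_integral 1 H x"
proof -
  have [measurable]: "G \<in> borel_measurable borel" "H \<in> borel_measurable borel"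
    using G H by auto
  have i: "integrable (lborel \<Otimes>\<^sub>M lborel) (\<lambda>(\<xi>, \<zeta>). cis (\<zeta> * x) * (G \<xi> * H (\<zeta> - \<xi>)))"
    using integrable_cis_mult[OF integrable_conv_pair[OF assms], of "\<lambda>(\<xi>, \<zeta>). \<zeta> * x"]
    by (simp add: split_def)
  have "osc_integral 1 (conv G H) x = (\<integral>\<zeta>. (\<integral>\<xi>. cis (\<zeta> * x) * (G \<xi> * H (\<zeta> - \<xi>)) \<partial>lborel) \<partial>lborel)"
    by (simp add: osc_integral_def conv_def)
  also have "\<dots> = (\<integral>\<xi>. (\<integral>\<zeta>. cis (\<zeta> * x) * (G \<xi> * H (\<zeta> - \<xi>)) \<partial>lborel) \<partial>lborel)"
    by (rule lborel_pair.Fubini_integral[OF i])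
  also have "\<dots> = (\<integral>\<xi>. (cis (\<xi> * x) * G \<xi>) * osc_integral 1 H x \<partial>lborel)"
  proof (intro Bochner_Integration.integral_cong refl)
    fix \<xi>
    have "cis (\<zeta> * x) * (G \<xi> * H (\<zeta> - \<xi>)) = (cis (\<xi> * x) * G \<xi>) * (cis ((\<zeta> - \<xi>) * x) * H (\<zeta> - \<xi>))" for \<zeta>
    proof -
      have "cis (\<zeta> * x) = cis (\<xi> * x) * cis ((\<zeta> - \<xi>) * x)"
        by (simp add: cis_mult algebra_simps)
      then show ?thesis by simp
    qed
    then show "(\<integral>\<zeta>. cis (\<zeta> * x) * (G \<xi> * H (\<zeta> - \<xi>)) \<partial>lborel) = (cis (\<xi> * x) * G \<xi>) * osc_integral 1 H x"
      using integral_shift[of "\<lambda>\<zeta>. cis (\<zeta> * x) * H \<zeta>" \<xi>]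
      by (simp only: integral_mult_right_zero osc_integral_def mult_1)
  qed
  also have "\<dots> = osc_integral 1 G x * osc_integral 1 H x"
    unfolding integral_mult_left_zero by (simp add: osc_integral_def[of 1 G])
  finally show ?thesis .
qed

lemma inv_fourier_mult:
  assumes G: "integrable lborel G" and H: "integrable lborel H"
  shows "inv_fourier G x * inv_fourier H x = inv_fourier (\<lambda>\<zeta>. conv G H \<zeta> / (2 * of_real pi)) x"
proof -
  have "osc_integral 1 (\<lambda>\<zeta>. conv G H \<zeta> / (2 * of_real pi)) x = osc_integral 1 (conv G H) x / (2 * of_real pi)"
    unfolding osc_integral_def by (subst integral_divide_zero[symmetric]) simp
  then show ?thesis
    by (simp add: inv_fourier_def osc_integral_conv[OF assms])
qed

section \<open>Band-limited symbols and the linear evolution\<close>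

text \<open>The explicit bound \<open>B\<close> and radius \<open>R\<close> are carried along because the estimates need them uniformly in
  time.\<close>

definition band_limited :: "real \<Rightarrow> real \<Rightarrow> (real \<Rightarrow> complex) \<Rightarrow> bool" where
  "band_limited R B g \<longleftrightarrow> g \<in> borel_measurable borel \<and> (\<forall>\<xi>. norm (g \<xi>) \<le> B * indicator {-R..R} \<xi>)"

lemma band_limited_measurable [measurable_dest]: "band_limited R B g \<Longrightarrow> g \<in> borel_measurable borel"
  by (simp add: band_limited_def)

lemma band_limited_norm: "band_limited R B g \<Longrightarrow> norm (g \<xi>) \<le> B * indicator {-R..R} \<xi>"
  by (simp add: band_limited_def)

lemma band_limited_integrable:
  assumes "band_limited R B g"
  shows "integrable lborel g"
proof (rule Bochner_Integration.integrable_bound)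
  show "integrable lborel (\<lambda>\<xi>. B * indicator {-R..R} \<xi>)"
    by (intro integrable_mult_right integrable_real_indicator) (use emeasure_bounded_finite[of "{-R..R}"] in auto)
  show "g \<in> borel_measurable lborel" using assms by (simp add: band_limited_def)
  show "AE \<xi> in lborel. norm (g \<xi>) \<le> norm (B * indicator {-R..R} \<xi> :: real)"
    unfolding real_norm_def
    by (intro AE_I2 order_trans[OF band_limited_norm[OF assms] abs_ge_self])
qed

lemma band_limited_mult:
  assumes g: "band_limited R B g" and [measurable]: "m \<in> borel_measurable borel"
    and m: "\<And>\<xi>. \<bar>\<xi>\<bar> \<le> R \<Longrightarrow> norm (m \<xi>) \<le> C" and "0 \<le> C"
  shows "band_limited R (C * B) (\<lambda>\<xi>. m \<xi> * g \<xi>)"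
  unfolding band_limited_def
proof (intro conjI allI)
  have [measurable]: "g \<in> borel_measurable borel" using g by (rule band_limited_measurable)
  show "(\<lambda>\<xi>. m \<xi> * g \<xi>) \<in> borel_measurable borel" by simp
  fix \<xi>
  show "norm (m \<xi> * g \<xi>) \<le> C * B * indicator {-R..R} \<xi>"
  proof (cases "\<bar>\<xi>\<bar> \<le> R")
    case True
    then show ?thesis
      using mult_mono[OF m[OF True] band_limited_norm[OF g, of \<xi>]] \<open>0 \<le> C\<close>
      by (simp add: norm_mult mult.assoc)
  next
    case False
    then have "\<xi> \<notin> {-R..R}" by auto
    then show ?thesis using band_limited_norm[OF g, of \<xi>] by simp
  qed
qed

lemma band_limited_mult_continuous:
  assumes g: "band_limited R B g" and m: "continuous_on UNIV m"
  shows "\<exists>C. band_limited R C (\<lambda>\<xi>. m \<xi> * g \<xi>)"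
proof -
  have "compact (m ` {-R..R})"
    by (intro compact_continuous_image continuous_on_subset[OF m]) auto
  then obtain C where C: "C > 0" "\<And>y. y \<in> m ` {-R..R} \<Longrightarrow> norm y \<le> C"
    using compact_imp_bounded bounded_pos by metis
  have "band_limited R (C * B) (\<lambda>\<xi>. m \<xi> * g \<xi>)"
    using C by (intro band_limited_mult[OF g] borel_measurable_continuous_onI m) (auto simp: abs_le_iff)
  then show ?thesis by blast
qed

lemma continuous_on_\<gamma>: "continuous_on S \<gamma>"
  unfolding \<gamma>_def[abs_def] by (intro continuous_intros)

lemma measurable_\<gamma> [measurable]: "\<gamma> \<in> borel_measurable borel"
  by (intro borel_measurable_continuous_onI continuous_on_\<gamma>)

lemma \<gamma>_nonneg: "\<gamma> \<xi> \<ge> 0"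
  by (simp add: \<gamma>_def)

lemma Vc_symbol: "(cis a + cis (- a)) / 2 = complex_of_real (cos a)"
  by (simp add: complex_eq_iff)

text \<open>Valid also for \<open>c = 0\<close>, where both quotients are \<open>0\<close>.\<close>

lemma Vs_symbol: "(cis a - cis (- a)) / (2 * \<i> * complex_of_real c) = complex_of_real (sin a / c)"
proof -
  have "cis a - cis (- a) = 2 * \<i> * complex_of_real (sin a)"
    by (simp add: complex_eq_iff)
  then show ?thesis by (cases "c = 0") auto
qed

text \<open>The symbol of \<^const>\<open>Vs\<close> is bounded by the elapsed time, uniformly in frequency.\<close>

lemma abs_sin_div_le: "\<bar>sin (\<tau> * c) / c\<bar> \<le> \<bar>\<tau>\<bar>" for c :: real
proof (cases "c = 0")
  case False
  have "\<bar>sin (\<tau> * c)\<bar> \<le> \<bar>\<tau> * c\<bar>" by (rule abs_sin_x_le_abs_x)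
  then show ?thesis using False by (simp add: abs_mult divide_le_eq)
qed simp

lemma Vc_fourier:
  assumes u: "has_fourier u g" and g: "band_limited R B g"
  shows "Vc t u = inv_fourier_dist (\<lambda>\<xi>. of_real (cos (t * \<gamma> \<xi>)) * g \<xi>)"
proof -
  have "integrable lborel (\<lambda>\<xi>. of_real (cos (t * \<gamma> \<xi>)) * g \<xi>)"
    by (rule band_limited_integrable[OF band_limited_mult[OF g, of _ 1]]) auto
  then show ?thesis
    unfolding Vc_def Vc_symbol by (intro fourier_mult_eq u) auto
qed

lemma Vs_fourier:
  assumes u: "has_fourier u g" and g: "band_limited R B g"
  shows "Vs t u = inv_fourier_dist (\<lambda>\<xi>. of_real (sin (t * \<gamma> \<xi>) / \<gamma> \<xi>) * g \<xi>)"
proof -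
  have "integrable lborel (\<lambda>\<xi>. of_real (sin (t * \<gamma> \<xi>) / \<gamma> \<xi>) * g \<xi>)"
    by (rule band_limited_integrable[OF band_limited_mult[OF g, of _ "\<bar>t\<bar>"]])
      (auto simp only: norm_of_real abs_sin_div_le, auto)
  then show ?thesis
    unfolding Vs_def Vs_symbol by (intro fourier_mult_eq u) auto
qed

lemma inv_fourier_dist_zero: "inv_fourier_dist (\<lambda>_. 0) = (\<lambda>_. 0)"
  by (auto simp: inv_fourier_dist_def inv_fourier_def osc_integral_def regular_dist_def)

lemma has_fourier_zero: "has_fourier (\<lambda>_. 0) (\<lambda>_. 0)"
  using has_fourier_inv_fourier_dist[of "\<lambda>_. 0"] by (simp add: inv_fourier_dist_zero)

lemma zero_sobolev: "(\<lambda>_. 0) \<in> sobolev s"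
  using has_fourier_zero inv_fourier_dist_tempered[of "\<lambda>_. 0"]
  by (auto simp: sobolev_def inv_fourier_dist_zero intro!: exI[of _ "\<lambda>_. 0"])

lemma sobolev_norm_zero: "sobolev_norm s (\<lambda>_. 0) = 0"
  by (simp add: sobolev_norm_eq[OF has_fourier_zero])

text \<open>Data with \<open>\<psi> = 0\<close> leave only the cosine part of the evolution.\<close>

lemma Vs_dist_deriv_zero: "Vs t (dist_deriv (\<lambda>_. 0)) = (\<lambda>_. 0)"
proof -
  have "has_fourier (dist_deriv (\<lambda>_. 0)) (\<lambda>_. 0)"
    using has_fourier_dist_deriv[OF has_fourier_zero] by simp
  from Vs_fourier[OF this, of 0 0 t] show ?thesis
    by (simp add: band_limited_def inv_fourier_dist_zero)
qed

section \<open>Smoothness of free waves\<close>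

text \<open>The \<open>i\<close>-th time and \<open>j\<close>-th space derivative of the plane-wave superposition with phase
  \<open>x \<xi> + \<sigma> t \<gamma> \<xi>\<close>. The signs \<open>\<sigma> = 1\<close> and \<open>\<sigma> = -1\<close> are the two halves of the cosine.\<close>

definition wave_integral :: "(real \<Rightarrow> complex) \<Rightarrow> real \<Rightarrow> nat \<Rightarrow> nat \<Rightarrow> real \<Rightarrow> real \<Rightarrow> complex" where
  "wave_integral g \<sigma> i j t x = (\<integral>\<xi>. cis (x * \<xi> + t * (\<sigma> * \<gamma> \<xi>)) *
     ((\<i> * of_real (\<sigma> * \<gamma> \<xi>)) ^ i * (\<i> * of_real \<xi>) ^ j * g \<xi>) \<partial>lborel)"

lemma wave_integral_amplitude_integrable:
  assumes g: "band_limited R B g" and m: "continuous_on UNIV m"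
  shows "integrable lborel (\<lambda>\<xi>. m \<xi> * ((\<i> * of_real (\<sigma> * \<gamma> \<xi>)) ^ i * (\<i> * of_real \<xi>) ^ j * g \<xi>))"
proof -
  have "continuous_on UNIV (\<lambda>\<xi>. m \<xi> * ((\<i> * of_real (\<sigma> * \<gamma> \<xi>)) ^ i * (\<i> * of_real \<xi>) ^ j))"
    by (intro continuous_intros m continuous_on_\<gamma>)
  from band_limited_mult_continuous[OF g this] show ?thesis
    by (auto simp: mult.assoc dest: band_limited_integrable)
qed

lemma wave_integral_time_derivative:
  assumes g: "band_limited R B g"
  shows "((\<lambda>\<tau>. wave_integral g \<sigma> i j \<tau> x) has_vector_derivative wave_integral g \<sigma> (Suc i) j t x) (at t within S)"
proof -
  let ?K = "\<lambda>\<xi>. (\<i> * of_real (\<sigma> * \<gamma> \<xi>)) ^ i * (\<i> * of_real \<xi>) ^ j * g \<xi>"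
  have "((\<lambda>\<tau>. \<integral>\<xi>. cis (\<tau> * (\<sigma> * \<gamma> \<xi>) + x * \<xi>) * ?K \<xi> \<partial>lborel) has_vector_derivative
     (\<integral>\<xi>. cis (t * (\<sigma> * \<gamma> \<xi>) + x * \<xi>) * (\<i> * of_real (\<sigma> * \<gamma> \<xi>) * ?K \<xi>) \<partial>lborel)) (at t within S)"
  proof (rule has_vector_derivative_cis_integral)
    show "integrable lborel ?K"
      using wave_integral_amplitude_integrable[OF g, of "\<lambda>_. 1"] by simp
    show "integrable lborel (\<lambda>\<xi>. of_real (\<sigma> * \<gamma> \<xi>) * ?K \<xi>)"
      "integrable lborel (\<lambda>\<xi>. of_real ((\<sigma> * \<gamma> \<xi>)\<^sup>2) * ?K \<xi>)"
      by (intro wave_integral_amplitude_integrable[OF g] continuous_intros continuous_on_\<gamma>)+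
  qed auto
  then show ?thesis
    by (simp add: wave_integral_def[abs_def] add.commute mult.assoc)
qed

lemma wave_integral_space_derivative:
  assumes g: "band_limited R B g"
  shows "(wave_integral g \<sigma> i j t has_vector_derivative wave_integral g \<sigma> i (Suc j) t x) (at x)"
proof -
  let ?K = "\<lambda>\<xi>. (\<i> * of_real (\<sigma> * \<gamma> \<xi>)) ^ i * (\<i> * of_real \<xi>) ^ j * g \<xi>"
  have "((\<lambda>x. \<integral>\<xi>. cis (x * \<xi> + t * (\<sigma> * \<gamma> \<xi>)) * ?K \<xi> \<partial>lborel) has_vector_derivative
     (\<integral>\<xi>. cis (x * \<xi> + t * (\<sigma> * \<gamma> \<xi>)) * (\<i> * of_real \<xi> * ?K \<xi>) \<partial>lborel)) (at x)"
  proof (rule has_vector_derivative_cis_integral)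
    show "integrable lborel ?K"
      using wave_integral_amplitude_integrable[OF g, of "\<lambda>_. 1"] by simp
    show "integrable lborel (\<lambda>\<xi>. of_real \<xi> * ?K \<xi>)" "integrable lborel (\<lambda>\<xi>. of_real (\<xi>\<^sup>2) * ?K \<xi>)"
      by (intro wave_integral_amplitude_integrable[OF g] continuous_intros)+
  qed auto
  moreover have "\<i> * of_real \<xi> * ?K \<xi> = (\<i> * of_real (\<sigma> * \<gamma> \<xi>)) ^ i * (\<i> * of_real \<xi>) ^ Suc j * g \<xi>" for \<xi>
    by (simp only: power_Suc mult_ac)
  ultimately show ?thesis
    by (simp only: wave_integral_def[abs_def])
qed

lemma wave_integral_continuous:
  assumes g: "band_limited R B g"
  shows "continuous_on S (\<lambda>(t, x). wave_integral g \<sigma> i j t x)"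
proof (rule continuous_on_sequentiallyI)
  fix u :: "nat \<Rightarrow> real \<times> real" and a assume u: "u \<longlonglongrightarrow> a"
  let ?K = "\<lambda>\<xi>. (\<i> * of_real (\<sigma> * \<gamma> \<xi>)) ^ i * (\<i> * of_real \<xi>) ^ j * g \<xi>"
  have [measurable]: "g \<in> borel_measurable borel" using g by (rule band_limited_measurable)
  have "(\<lambda>n. \<integral>\<xi>. cis (snd (u n) * \<xi> + fst (u n) * (\<sigma> * \<gamma> \<xi>)) * ?K \<xi> \<partial>lborel)
      \<longlonglongrightarrow> (\<integral>\<xi>. cis (snd a * \<xi> + fst a * (\<sigma> * \<gamma> \<xi>)) * ?K \<xi> \<partial>lborel)"
  proof (rule integral_dominated_convergence)
    show "integrable lborel (\<lambda>\<xi>. norm (?K \<xi>))"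
      using wave_integral_amplitude_integrable[OF g, of "\<lambda>_. 1"] by simp
    have "isCont cis y" for y
      using continuous_on_cis[OF continuous_on_id, of UNIV] by (simp add: continuous_on_eq_continuous_at)
    then show "AE \<xi> in lborel. (\<lambda>n. cis (snd (u n) * \<xi> + fst (u n) * (\<sigma> * \<gamma> \<xi>)) * ?K \<xi>)
        \<longlonglongrightarrow> cis (snd a * \<xi> + fst a * (\<sigma> * \<gamma> \<xi>)) * ?K \<xi>"
      by (intro AE_I2 tendsto_mult tendsto_const isCont_tendsto_compose[of _ cis] tendsto_add
          tendsto_fst tendsto_snd u) auto
    show "AE \<xi> in lborel. norm (cis (snd (u n) * \<xi> + fst (u n) * (\<sigma> * \<gamma> \<xi>)) * ?K \<xi>) \<le> norm (?K \<xi>)" for n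
      by (simp add: norm_mult)
  qed auto
  then show "(\<lambda>n. case u n of (t, x) \<Rightarrow> wave_integral g \<sigma> i j t x) \<longlonglongrightarrow> (case a of (t, x) \<Rightarrow> wave_integral g \<sigma> i j t x)"
    by (simp add: wave_integral_def split_def)
qed

text \<open>The Fourier transform at time \<open>t\<close> of the solution with initial data \<open>g\<close> (on the Fourier side) and
  initial velocity \<open>0\<close>.\<close>

definition cos_symbol :: "(real \<Rightarrow> complex) \<Rightarrow> real \<Rightarrow> real \<Rightarrow> complex" where
  "cos_symbol g t \<xi> = of_real (cos (t * \<gamma> \<xi>)) * g \<xi>"

definition free_wave :: "(real \<Rightarrow> complex) \<Rightarrow> real \<Rightarrow> real \<Rightarrow> complex" where
  "free_wave g t = inv_fourier (cos_symbol g t)"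

lemma free_wave_eq_wave:
  assumes g: "band_limited R B g"
  shows "free_wave g t x = (wave_integral g 1 0 0 t x + wave_integral g (-1) 0 0 t x) / (4 * of_real pi)"
proof -
  have i: "integrable lborel (\<lambda>\<xi>. cis (x * \<xi> + t * (\<sigma> * \<gamma> \<xi>)) * g \<xi>)" for \<sigma>
    by (intro integrable_cis_mult band_limited_integrable[OF g]) auto
  have "osc_integral 1 (cos_symbol g t) x
      = (\<integral>\<xi>. (cis (x * \<xi> + t * (1 * \<gamma> \<xi>)) * g \<xi> + cis (x * \<xi> + t * (-1 * \<gamma> \<xi>)) * g \<xi>) / 2 \<partial>lborel)"
    unfolding osc_integral_def cos_symbol_def
  proof (intro Bochner_Integration.integral_cong refl)
    fix \<xi>
    have "cis (x * \<xi> + t * (1 * \<gamma> \<xi>)) + cis (x * \<xi> + t * (-1 * \<gamma> \<xi>))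
        = cis (x * \<xi>) * (cis (t * \<gamma> \<xi>) + cis (- (t * \<gamma> \<xi>)))"
      by (simp add: distrib_left cis_mult)
    then show "cis (1 * \<xi> * x) * (of_real (cos (t * \<gamma> \<xi>)) * g \<xi>)
      = (cis (x * \<xi> + t * (1 * \<gamma> \<xi>)) * g \<xi> + cis (x * \<xi> + t * (-1 * \<gamma> \<xi>)) * g \<xi>) / 2"
      by (simp only: Vc_symbol[symmetric] distrib_right[symmetric]) (simp add: mult.commute)
  qed
  also have "\<dots> = (wave_integral g 1 0 0 t x + wave_integral g (-1) 0 0 t x) / 2"
    unfolding integral_divide_zero using i[of 1] i[of "-1"] by (simp add: wave_integral_def)
  finally show ?thesis
    by (simp only: free_wave_def inv_fourier_def) simp
qed

lemma smooth_strip_free_wave: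
  assumes g: "band_limited R B g"
  shows "smooth_strip T (free_wave g)"
  unfolding smooth_strip_def
proof (rule exI[of _ "\<lambda>i j t x. (wave_integral g 1 i j t x + wave_integral g (-1) i j t x) / (4 * of_real pi)"],
    intro conjI allI ballI)
  let ?D = "\<lambda>i j t x. (wave_integral g 1 i j t x + wave_integral g (-1) i j t x) / (4 * of_real pi)"
  show "?D 0 0 = free_wave g"
    by (auto simp: fun_eq_iff free_wave_eq_wave[OF g])
  fix i j
  show "continuous_on ({0..T} \<times> UNIV) (\<lambda>(t, x). ?D i j t x)"
    using continuous_on_divide[OF continuous_on_add[OF wave_integral_continuous[OF g, of _ 1 i j]
        wave_integral_continuous[OF g, of _ "-1" i j]] continuous_on_const[of _ "4 * of_real pi"]]
    by (simp add: split_def)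
  fix t x :: real assume "t \<in> {0..T}"
  show "((\<lambda>\<tau>. ?D i j \<tau> x) has_vector_derivative ?D (Suc i) j t x) (at t within {0..T})"
    by (intro has_vector_derivative_divide has_vector_derivative_add wave_integral_time_derivative[OF g])
  show "(?D i j t has_vector_derivative ?D i (Suc j) t x) (at x)"
    by (intro has_vector_derivative_divide has_vector_derivative_add
        wave_integral_space_derivative[OF g])
qed

section \<open>The Duhamel term of a free wave\<close>

text \<open>The support is contained in the sum of the two supports, and the integrand lives on an interval of
  length \<open>2 R\<close>.\<close>

lemma conv_band_limited:
  assumes g: "band_limited R B g" and h: "band_limited R B h" and B: "0 \<le> B" and R: "0 \<le> R"
  shows "band_limited (2 * R) (2 * R * B\<^sup>2) (conv g h)"
  unfolding band_limited_def
proof (intro conjI allI)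
  have gi: "integrable lborel g" and hi: "integrable lborel h"
    using g h by (auto intro: band_limited_integrable)
  show "conv g h \<in> borel_measurable borel"
    using conv_integrable[OF gi hi] by auto
  fix \<zeta>
  have pt: "norm (g \<xi> * h (\<zeta> - \<xi>)) \<le> B\<^sup>2 * indicator {-R..R} \<xi> * indicator {- (2 * R)..2 * R} \<zeta>" for \<xi>
  proof -
    have "norm (g \<xi> * h (\<zeta> - \<xi>))
        \<le> (B * indicator {-R..R} \<xi>) * (B * indicator {-R..R} (\<zeta> - \<xi>))"
      unfolding norm_mult using B by (intro mult_mono band_limited_norm g h) auto
    also have "\<dots> \<le> B\<^sup>2 * indicator {-R..R} \<xi> * indicator {- (2 * R)..2 * R} \<zeta>"
      by (auto simp: indicator_def power2_eq_square)
    finally show ?thesis .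
  qed
  have I: "integrable lborel (\<lambda>\<xi>. B\<^sup>2 * indicator {-R..R} \<xi> * indicator {- (2 * R)..2 * R} \<zeta> :: real)"
    using R by simp
  have "norm (conv g h \<zeta>) \<le> (\<integral>\<xi>. norm (g \<xi> * h (\<zeta> - \<xi>)) \<partial>lborel)"
    unfolding conv_def by (rule integral_norm_bound)
  also have "\<dots> \<le> (\<integral>\<xi>. B\<^sup>2 * indicator {-R..R} \<xi> * indicator {- (2 * R)..2 * R} \<zeta> \<partial>lborel)"
    by (rule integral_mono_AE'[OF I]) (use pt in auto)
  also have "\<dots> = 2 * R * B\<^sup>2 * indicator {- (2 * R)..2 * R} \<zeta>"
    using R by simp
  finally show "norm (conv g h \<zeta>) \<le> 2 * R * B\<^sup>2 * indicator {- (2 * R)..2 * R} \<zeta>" .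
qed

text \<open>The Fourier transform of the square of the free wave.\<close>

definition square_symbol :: "(real \<Rightarrow> complex) \<Rightarrow> real \<Rightarrow> real \<Rightarrow> complex" where
  "square_symbol g t \<xi> = conv (cos_symbol g t) (cos_symbol g t) \<xi> / (2 * of_real pi)"

text \<open>The Fourier transform of the Duhamel integrand. The two factors \<open>\<i> \<xi>\<close> come from the two space
  derivatives.\<close>

definition integrand_symbol :: "(real \<Rightarrow> complex) \<Rightarrow> real \<Rightarrow> real \<Rightarrow> real \<Rightarrow> complex" where
  "integrand_symbol g t t' \<xi> = of_real (sin ((t - t') * \<gamma> \<xi>) / \<gamma> \<xi>) *
     (\<i> * of_real \<xi> * (\<i> * of_real \<xi> * square_symbol g t' \<xi>))"

lemma cos_symbol_band_limited: "band_limited R B g \<Longrightarrow> band_limited R B (cos_symbol g t)"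
  using band_limited_mult[of R B g "\<lambda>\<xi>. of_real (cos (t * \<gamma> \<xi>))" 1] by (simp add: cos_symbol_def[abs_def])

lemma square_symbol_band_limited:
  assumes g: "band_limited R 1 g" and R: "0 \<le> R"
  shows "band_limited (2 * R) R (square_symbol g t)"
proof -
  have "band_limited (2 * R) (2 * R * 1\<^sup>2) (conv (cos_symbol g t) (cos_symbol g t))"
    by (rule conv_band_limited) (use R cos_symbol_band_limited[OF g] in auto)
  from band_limited_mult[OF this, of "\<lambda>_. 1 / (2 * of_real pi)" "1/2"]
  show ?thesis using pi_gt3
    by (simp add: square_symbol_def[abs_def] norm_divide norm_mult divide_le_eq)
qed

lemma square_symbol_measurable_pair:
  assumes [measurable]: "g \<in> borel_measurable borel"
  shows "(\<lambda>(t, \<xi>). square_symbol g t \<xi>) \<in> borel_measurable (borel \<Otimes>\<^sub>M borel)"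
  unfolding square_symbol_def conv_def cos_symbol_def by measurable

lemma integrand_symbol_measurable_pair:
  assumes g[measurable]: "g \<in> borel_measurable borel"
  shows "(\<lambda>(t', \<xi>). integrand_symbol g t t' \<xi>) \<in> borel_measurable (borel \<Otimes>\<^sub>M borel)"
proof -
  note [measurable] = square_symbol_measurable_pair[OF g]
  show ?thesis unfolding integrand_symbol_def by measurable
qed

lemma laplace_band_limited:
  assumes "band_limited R C h" "0 \<le> R" "0 \<le> C"
  shows "band_limited R (R * (R * C)) (\<lambda>\<xi>. \<i> * of_real \<xi> * (\<i> * of_real \<xi> * h \<xi>))"
  by (intro band_limited_mult assms) (use assms in \<open>auto simp: norm_mult\<close>)

lemma integrand_symbol_band_limited:
  assumes g: "band_limited R 1 g" and R: "0 \<le> R"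
  shows "band_limited (2 * R) (\<bar>t - t'\<bar> * (2 * R * (2 * R * R))) (integrand_symbol g t t')"
  unfolding integrand_symbol_def[abs_def]
proof (rule band_limited_mult)
  show "band_limited (2 * R) (2 * R * (2 * R * R))
      (\<lambda>\<xi>. \<i> * of_real \<xi> * (\<i> * of_real \<xi> * square_symbol g t' \<xi>))"
    by (rule laplace_band_limited[OF square_symbol_band_limited[OF g R]]) (use R in auto)
  show "norm (complex_of_real (sin ((t - t') * \<gamma> \<xi>) / \<gamma> \<xi>)) \<le> \<bar>t - t'\<bar>" for \<xi>
    by (simp only: norm_of_real abs_sin_div_le)
qed auto

lemma free_wave_square:
  assumes g: "band_limited R 1 g"
  shows "regular_dist (\<lambda>x. free_wave g t x * free_wave g t x) = inv_fourier_dist (square_symbol g t)"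
proof -
  have "integrable lborel (cos_symbol g t)" using cos_symbol_band_limited[OF g] by (rule band_limited_integrable)
  then show ?thesis
    by (simp add: inv_fourier_dist_def free_wave_def inv_fourier_mult square_symbol_def[abs_def])
qed

lemma duhamel_integrand_free_wave:
  assumes g: "band_limited R 1 g" and R: "0 \<le> R"
  shows "duhamel_integrand (free_wave g) (free_wave g) t t' = inv_fourier_dist (integrand_symbol g t t')"
proof -
  note sq = square_symbol_band_limited[OF g R, of t']
  have "has_fourier (dist_deriv (dist_deriv (inv_fourier_dist (square_symbol g t'))))
      (\<lambda>\<xi>. \<i> * of_real \<xi> * (\<i> * of_real \<xi> * square_symbol g t' \<xi>))"
    by (intro has_fourier_dist_deriv has_fourier_inv_fourier_dist band_limited_integrable[OF sq])
  from Vs_fourier[OF this laplace_band_limited[OF sq]] show ?thesis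
    using R by (simp add: duhamel_integrand_def free_wave_square[OF g] integrand_symbol_def[abs_def])
qed

text \<open>The time integral taken pointwise in frequency. It turns out to be the Fourier transform of the
  Duhamel term.\<close>

definition duhamel_symbol :: "(real \<Rightarrow> complex) \<Rightarrow> real \<Rightarrow> real \<Rightarrow> complex" where
  "duhamel_symbol g t \<xi> = (\<integral>t'. indicator {0..t} t' * integrand_symbol g t t' \<xi> \<partial>lborel)"

lemma norm_integrand_symbol_cutoff:
  assumes g: "band_limited R 1 g" and R: "0 \<le> R"
  shows "norm (indicator {0..t} t' * integrand_symbol g t t' \<xi>)
     \<le> \<bar>t\<bar> * (4 * R ^ 3) * indicator {0..t} t' * indicator {- (2 * R)..2 * R} \<xi>"
proof (cases "t' \<in> {0..t}")
  case True
  have "norm (integrand_symbol g t t' \<xi>)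
      \<le> \<bar>t - t'\<bar> * (2 * R * (2 * R * R)) * indicator {- (2 * R)..2 * R} \<xi>"
    by (rule band_limited_norm[OF integrand_symbol_band_limited[OF g R]])
  also have "\<dots> \<le> \<bar>t\<bar> * (2 * R * (2 * R * R)) * indicator {- (2 * R)..2 * R} \<xi>"
    using True R by (intro mult_right_mono) auto
  finally show ?thesis using True by (simp add: power3_eq_cube mult_ac)
qed simp

lemma duhamel_symbol_band_limited:
  assumes g: "band_limited R 1 g" and R: "0 \<le> R" and t: "0 \<le> t"
  shows "band_limited (2 * R) (t\<^sup>2 * (4 * R ^ 3)) (duhamel_symbol g t)"
  unfolding band_limited_def
proof (intro conjI allI)
  have [measurable]: "g \<in> borel_measurable borel" using g by (rule band_limited_measurable)
  note [measurable] = integrand_symbol_measurable_pair[of g t]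
  show "duhamel_symbol g t \<in> borel_measurable borel"
    unfolding duhamel_symbol_def[abs_def] by measurable
  fix \<xi>
  have I: "integrable lborel (\<lambda>t'. t * (4 * R ^ 3) * indicator {0..t} t' * indicator {- (2 * R)..2 * R} \<xi> :: real)"
    using t by simp
  have "norm (duhamel_symbol g t \<xi>) \<le> (\<integral>t'. norm (indicator {0..t} t' * integrand_symbol g t t' \<xi>) \<partial>lborel)"
    unfolding duhamel_symbol_def by (rule integral_norm_bound)
  also have "\<dots> \<le> (\<integral>t'. t * (4 * R ^ 3) * indicator {0..t} t' * indicator {- (2 * R)..2 * R} \<xi> \<partial>lborel)"
    by (rule integral_mono_AE'[OF I]; intro AE_I2)
      (use norm_integrand_symbol_cutoff[OF g R, of t _ \<xi>] t R in \<open>simp_all\<close>)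
  also have "\<dots> = t\<^sup>2 * (4 * R ^ 3) * indicator {- (2 * R)..2 * R} \<xi>"
    using t by (simp add: power2_eq_square)
  finally show "norm (duhamel_symbol g t \<xi>) \<le> t\<^sup>2 * (4 * R ^ 3) * indicator {- (2 * R)..2 * R} \<xi>" .
qed

lemma free_wave_bounded:
  assumes g: "band_limited R 1 g"
  shows "free_wave g t \<in> borel_measurable borel"
    and "norm (free_wave g t x) \<le> (\<integral>\<xi>. norm (cos_symbol g t \<xi>) \<partial>lborel)"
  using band_limited_integrable[OF cos_symbol_band_limited[OF g, of t]]
  unfolding free_wave_def by (auto intro: norm_inv_fourier_le)

text \<open>By definition the Duhamel term integrates the pairings with a test function over time. Each pairing
  is an integral over frequency against the inverse Fourier transform of that function, and Fubini's
  theorem exchanges the two integrals; the indicator of \<open>{0..t}\<close> makes the kernel bounded.\<close>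

lemma duhamel_free_wave_pairing:
  assumes g: "band_limited R 1 g" and R: "0 \<le> R" and f: "f \<in> schwartz"
  shows "set_integrable lborel {0..t} (\<lambda>t'. duhamel_integrand (free_wave g) (free_wave g) t t' f)"
    and "0 \<le> t \<Longrightarrow> (LINT t':{0..t}|lborel. duhamel_integrand (free_wave g) (free_wave g) t t' f)
       = inv_fourier_dist (duhamel_symbol g t) f"
proof -
  let ?f = "inv_fourier f"
  let ?m = "\<lambda>t' \<xi>. indicator {0..t} t' * integrand_symbol g t t' \<xi>"
  have [measurable]: "g \<in> borel_measurable borel" using g by (rule band_limited_measurable)
  note [measurable] = integrand_symbol_measurable_pair[of g t]
  have fi: "integrable lborel ?f" using f by (intro schwartz_integrable schwartz_inv_fourier)
  have one: "integrable lborel (\<lambda>t'. indicator {0..t} t' :: complex)"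
  proof -
    have "integrable lborel (\<lambda>t'. complex_of_real (indicator {0..t} t'))"
      using emeasure_bounded_finite[of "{0..t}"] by (intro integrable_of_real integrable_real_indicator) auto
    then show ?thesis by (simp only: of_real_indicator)
  qed
  have m: "(\<lambda>(t', \<xi>). ?m t' \<xi>) \<in> borel_measurable (borel \<Otimes>\<^sub>M borel)" by measurable
  have b: "norm (?m t' \<xi>) \<le> \<bar>t\<bar> * (4 * R ^ 3)" for t' \<xi>
    by (rule order_trans[OF norm_integrand_symbol_cutoff[OF g R]])
      (use R in \<open>auto simp: indicator_def\<close>)
  have pair: "duhamel_integrand (free_wave g) (free_wave g) t t' f
      = (\<integral>\<xi>. integrand_symbol g t t' \<xi> * ?f \<xi> \<partial>lborel)" for t'
    unfolding duhamel_integrand_free_wave[OF g R]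
    by (rule inv_fourier_dist_pairing[OF band_limited_integrable[OF integrand_symbol_band_limited[OF g R]] f])
  have eq: "indicator {0..t} t' *\<^sub>R duhamel_integrand (free_wave g) (free_wave g) t t' f
     = (\<integral>\<xi>. ?m t' \<xi> * indicator {0..t} t' * ?f \<xi> \<partial>lborel)" for t'
    by (cases "t' \<in> {0..t}") (simp_all add: pair)
  show "set_integrable lborel {0..t} (\<lambda>t'. duhamel_integrand (free_wave g) (free_wave g) t t' f)"
    using lborel_pair.integrable_fst[OF integrable_pair_kernel[OF one fi m b]]
    unfolding set_integrable_def eq by simp
  assume t: "0 \<le> t"
  have "(LINT t':{0..t}|lborel. duhamel_integrand (free_wave g) (free_wave g) t t' f)
     = (\<integral>t'. (\<integral>\<xi>. ?m t' \<xi> * ?f \<xi> \<partial>lborel) * indicator {0..t} t' \<partial>lborel)"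
    unfolding set_lebesgue_integral_def eq
    by (intro Bochner_Integration.integral_cong refl) (simp add: indicator_def)
  also have "\<dots> = (\<integral>\<xi>. (\<integral>t'. ?m t' \<xi> * indicator {0..t} t' \<partial>lborel) * ?f \<xi> \<partial>lborel)"
    by (rule Fubini_kernel[OF one fi m b, symmetric])
  also have "\<dots> = (\<integral>\<xi>. duhamel_symbol g t \<xi> * ?f \<xi> \<partial>lborel)"
  proof -
    have "?m t' \<xi> * indicator {0..t} t' = ?m t' \<xi>" for t' \<xi> by (simp add: indicator_def)
    then show ?thesis by (simp only: duhamel_symbol_def)
  qed
  also have "\<dots> = inv_fourier_dist (duhamel_symbol g t) f"
    by (rule inv_fourier_dist_pairing[symmetric, OF band_limited_integrable[OF duhamel_symbol_band_limited[OF g R t]] f])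
  finally show "(LINT t':{0..t}|lborel. duhamel_integrand (free_wave g) (free_wave g) t t' f)
     = inv_fourier_dist (duhamel_symbol g t) f" .
qed

lemma duhamel_defined_free_wave:
  assumes g: "band_limited R 1 g" and R: "0 \<le> R"
  shows "duhamel_defined T (free_wave g) (free_wave g)"
  unfolding duhamel_defined_def
proof (intro conjI ballI)
  fix t
  show "\<exists>h. has_fourier (regular_dist (\<lambda>x. free_wave g t x * free_wave g t x)) h"
    unfolding free_wave_square[OF g]
    using has_fourier_inv_fourier_dist[OF band_limited_integrable[OF square_symbol_band_limited[OF g R]]] by blast
  note [measurable] = free_wave_bounded(1)[OF g, of t]
  show "tempered_fun (\<lambda>x. free_wave g t x * free_wave g t x)"
    by (rule tempered_fun_bounded)
      (simp, simp only: norm_mult,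
        rule mult_mono[OF free_wave_bounded(2)[OF g] free_wave_bounded(2)[OF g]], auto)
qed (rule duhamel_free_wave_pairing(1)[OF g R])

lemma duhamel_free_wave:
  assumes g: "band_limited R 1 g" and R: "0 \<le> R" and t: "t \<in> {0..T}"
  shows "duhamel T (free_wave g) (free_wave g) t = inv_fourier_dist (duhamel_symbol g t)"
proof
  fix f
  show "duhamel T (free_wave g) (free_wave g) t f = inv_fourier_dist (duhamel_symbol g t) f"
  proof (cases "f \<in> schwartz")
    case True
    then show ?thesis
      using t duhamel_free_wave_pairing(2)[OF g R True] by (simp add: duhamel_def on_interval_def)
  next
    case False
    then show ?thesis
      using t by (simp add: duhamel_def on_interval_def duhamel_integrand_free_wave[OF g R]
          inv_fourier_dist_def regular_dist_def set_lebesgue_integral_def)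
  qed
qed

lemma smooth_rep_free_wave:
  assumes g: "band_limited R 1 g"
  shows "smooth_rep T (on_interval T (\<lambda>t. inv_fourier_dist (cos_symbol g t))) (free_wave g)"
  unfolding smooth_rep_def
proof (intro conjI ballI)
  show "smooth_strip T (free_wave g)" by (rule smooth_strip_free_wave[OF g])
  fix t assume "t \<in> {0..T}"
  then show "on_interval T (\<lambda>t. inv_fourier_dist (cos_symbol g t)) t = regular_dist (free_wave g t)"
    by (simp add: on_interval_def inv_fourier_dist_def free_wave_def[abs_def])
  show "tempered_fun (free_wave g t)"
    by (rule tempered_fun_bounded[OF free_wave_bounded[OF g]])
qed

text \<open>The curve that the linear estimate places in the space, for the data \<open>\<psi> = 0\<close>.\<close>

lemma free_solution_eq:
  assumes g: "band_limited R 1 g"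
  shows "on_interval T (\<lambda>t f. Vc t (inv_fourier_dist g) f + Vs t (dist_deriv (\<lambda>_. 0)) f)
    = on_interval T (\<lambda>t. inv_fourier_dist (cos_symbol g t))"
  using Vc_fourier[OF has_fourier_inv_fourier_dist[OF band_limited_integrable[OF g]] g]
  by (simp add: Vs_dist_deriv_zero cos_symbol_def[abs_def])

section \<open>The lower bound at low frequencies\<close>

text \<open>The constant \<open>1\<close> is convenient because \<open>1 \<le> \<pi> / 3\<close>.\<close>

lemma half_le_cos: "\<bar>x\<bar> \<le> 1 \<Longrightarrow> 1 / 2 \<le> cos x" for x :: real
  using cos_monotone_0_pi_le[of "\<bar>x\<bar>" "pi / 3"] pi_gt3 by (simp add: cos_60)

lemma half_le_sin:
  fixes x :: real
  assumes "0 \<le> x" "x \<le> 1"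
  shows "x / 2 \<le> sin x"
proof -
  have "sin 0 - 0 / 2 \<le> sin x - x / 2"
  proof (rule DERIV_nonneg_imp_nondecreasing[OF assms(1)])
    fix y :: real assume "0 \<le> y" "y \<le> x"
    then show "\<exists>d. ((\<lambda>x. sin x - x / 2) has_real_derivative d) (at y) \<and> 0 \<le> d"
      using half_le_cos[of y] assms by (intro exI[of _ "cos y - 1/2"]) (auto intro!: derivative_eq_intros)
  qed
  then show ?thesis by simp
qed

lemma \<gamma>_le:
  assumes "\<bar>\<xi>\<bar> \<le> M" "1 \<le> M"
  shows "\<gamma> \<xi> \<le> 2 * M\<^sup>2"
  unfolding \<gamma>_def
proof (rule real_le_lsqrt)
  have "\<xi>\<^sup>2 \<le> M\<^sup>2" "\<xi> ^ 4 \<le> M ^ 4"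
    using power_mono[OF assms(1), of 2] power_mono[OF assms(1), of 4] by simp_all
  moreover have "M\<^sup>2 \<le> M ^ 4" using assms by (intro power_increasing) auto
  moreover have "0 \<le> M ^ 4" using assms by simp
  moreover have "(2 * M\<^sup>2)\<^sup>2 = 4 * M ^ 4" by (simp add: power_mult_distrib flip: power_mult)
  ultimately show "\<xi>\<^sup>2 + \<xi> ^ 4 \<le> (2 * M\<^sup>2)\<^sup>2"
    by linarith
qed auto

text \<open>The band is symmetric so that frequencies near \<open>n\<close> and near \<open>- n\<close> can add up to a small one.\<close>

definition high_band :: "real \<Rightarrow> real set" where
  "high_band n = {- (n + 1)..- n} \<union> {n..n + 1}"

lemma high_band_measurable [measurable]: "high_band n \<in> sets borel"
  by (simp add: high_band_def)

lemma high_band_band_limited: "0 \<le> n \<Longrightarrow> band_limited (n + 1) 1 (indicator (high_band n))"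
  by (auto simp: band_limited_def high_band_def indicator_def)

text \<open>For \<open>\<eta>\<close> between \<open>n + \<xi>\<close> and \<open>n + 1\<close> both \<open>\<eta>\<close> and \<open>\<xi> - \<eta>\<close> lie in the band; this interval has length at least
  \<open>1 / 2\<close>. On the band the phase \<open>t \<gamma> \<eta>\<close> is at most \<open>8 n\<^sup>2 t \<le> 1\<close>, so both cosines are at least \<open>1 / 2\<close>, and nothing
  can cancel.\<close>

lemma conv_high_band_ge:
  assumes n: "1 \<le> n" and t: "0 \<le> t" "8 * n\<^sup>2 * t \<le> 1" and \<xi>: "\<xi> \<in> {1/4..1/2}"
  shows "\<exists>h \<ge> 1 / 8. conv (cos_symbol (indicator (high_band n)) t) (cos_symbol (indicator (high_band n)) t) \<xi> = of_real h"
proof (intro exI conjI)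
  let ?A = "high_band n"
  let ?r = "\<lambda>\<eta>. cos (t * \<gamma> \<eta>) * indicator ?A \<eta> * (cos (t * \<gamma> (\<xi> - \<eta>)) * indicator ?A (\<xi> - \<eta>))"
  show "conv (cos_symbol (indicator ?A) t) (cos_symbol (indicator ?A) t) \<xi> = of_real (\<integral>\<eta>. ?r \<eta> \<partial>lborel)"
    unfolding conv_def cos_symbol_def integral_complex_of_real[symmetric]
    by (simp only: of_real_mult of_real_indicator)
  have c: "1 / 2 \<le> cos (t * \<gamma> \<eta>)" if "\<eta> \<in> ?A" for \<eta>
  proof (rule half_le_cos)
    have "\<bar>\<eta>\<bar> \<le> n + 1" using that n by (auto simp: high_band_def)
    then have "\<gamma> \<eta> \<le> 2 * (n + 1)\<^sup>2" using n by (intro \<gamma>_le) auto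
    also have "\<dots> \<le> 2 * (2 * n)\<^sup>2" using n by (intro mult_left_mono power_mono) auto
    finally have "t * \<gamma> \<eta> \<le> t * (8 * n\<^sup>2)" using t by (intro mult_left_mono) (auto simp: power_mult_distrib)
    then show "\<bar>t * \<gamma> \<eta>\<bar> \<le> 1" using t \<gamma>_nonneg[of \<eta>] by (simp add: abs_mult mult_ac)
  qed
  have ge: "(1 / 4) * indicator {n + \<xi>..n + 1} \<eta> \<le> ?r \<eta>" for \<eta>
  proof (cases "\<eta> \<in> ?A \<and> \<xi> - \<eta> \<in> ?A")
    case True
    then have "1 / 2 * (1 / 2) \<le> cos (t * \<gamma> \<eta>) * cos (t * \<gamma> (\<xi> - \<eta>))"
      by (intro mult_mono c) (auto intro: order_trans[OF _ c])
    with True show ?thesis by (auto simp: indicator_def)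
  next
    case False
    then have "\<eta> \<notin> {n + \<xi>..n + 1}" using \<xi> by (auto simp: high_band_def)
    with False show ?thesis by (auto simp: indicator_def)
  qed
  have "(\<integral>\<eta>. (1 / 4) * indicator {n + \<xi>..n + 1} \<eta> \<partial>lborel) \<le> (\<integral>\<eta>. ?r \<eta> \<partial>lborel)"
  proof (rule integral_mono)
    show "integrable lborel (\<lambda>\<eta>. 1 / 4 * indicator {n + \<xi>..n + 1} \<eta> :: real)"
      using \<xi> by simp
    show "integrable lborel ?r"
    proof (rule Bochner_Integration.integrable_bound)
      show "integrable lborel (\<lambda>\<eta>. indicator {- (n + 1)..n + 1} \<eta> :: real)" using n by simp
      show "AE \<eta> in lborel. norm (?r \<eta>) \<le> norm (indicator {- (n + 1)..n + 1} \<eta> :: real)"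
      proof (intro AE_I2)
        fix \<eta>
        have "\<bar>cos (t * \<gamma> \<eta>)\<bar> * \<bar>cos (t * \<gamma> (\<xi> - \<eta>))\<bar> \<le> 1 * 1" by (intro mult_mono) auto
        then show "norm (?r \<eta>) \<le> norm (indicator {- (n + 1)..n + 1} \<eta> :: real)"
          using n by (auto simp: indicator_def high_band_def abs_mult)
      qed
    qed simp
  qed (rule ge)
  moreover have "1 / 8 \<le> (\<integral>\<eta>. (1 / 4) * indicator {n + \<xi>..n + 1} \<eta> \<partial>lborel :: real)"
    using \<xi> by simp
  ultimately show "1 / 8 \<le> (\<integral>\<eta>. ?r \<eta> \<partial>lborel)" by linarith
qed

text \<open>The integrand is real and nowhere positive. For times in the first half of \<open>{0..t}\<close> the factors of its
  modulus are at least \<open>(t - t') / 2 \<ge> t / 4\<close> for the sine quotient, \<open>1 / 16\<close> for \<open>\<xi>\<^sup>2\<close>, and \<open>1 / (16 \<pi>)\<close> for the Fourier transform of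
  the square; an interval of length \<open>t / 2\<close> contributes the remaining factor.\<close>

lemma duhamel_symbol_high_band_ge:
  assumes n: "1 \<le> n" and t: "0 \<le> t" "8 * n\<^sup>2 * t \<le> 1" and \<xi>: "\<xi> \<in> {1/4..1/2}"
  shows "t\<^sup>2 / (2048 * pi) \<le> norm (duhamel_symbol (indicator (high_band n)) t \<xi>)"
proof -
  let ?g = "indicator (high_band n) :: real \<Rightarrow> complex"
  let ?K = "\<lambda>t'. indicator {0..t} t' * integrand_symbol ?g t t' \<xi>"
  have g: "band_limited (n + 1) 1 ?g" using n by (intro high_band_band_limited) simp
  have [measurable]: "?g \<in> borel_measurable borel" using g by (rule band_limited_measurable)
  note [measurable] = integrand_symbol_measurable_pair[of ?g t]
  have R: "0 \<le> n + 1" using n by simp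
  have K: "integrable lborel ?K"
  proof (rule Bochner_Integration.integrable_bound)
    show "integrable lborel (\<lambda>t'. \<bar>t\<bar> * (4 * (n + 1) ^ 3) * indicator {0..t} t'
        * indicator {- (2 * (n + 1))..2 * (n + 1)} \<xi> :: real)"
      using t by simp
    show "AE t' in lborel. norm (?K t') \<le> norm (\<bar>t\<bar> * (4 * (n + 1) ^ 3) * indicator {0..t} t'
        * indicator {- (2 * (n + 1))..2 * (n + 1)} \<xi> :: real)"
      unfolding real_norm_def
      by (intro AE_I2 order_trans[OF norm_integrand_symbol_cutoff[OF g R] abs_ge_self])
  qed measurable
  have \<gamma>1: "\<gamma> \<xi> \<le> 1"
  proof -
    have "\<xi>\<^sup>2 \<le> (1/2)\<^sup>2" "\<xi> ^ 4 \<le> (1/2) ^ 4" using \<xi> by (auto intro!: power_mono)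
    then show ?thesis unfolding \<gamma>_def by (intro real_le_lsqrt) (auto simp: power_divide)
  qed
  have \<gamma>0: "\<gamma> \<xi> > 0" using \<xi> by (auto simp: \<gamma>_def intro!: add_pos_nonneg)
  have \<xi>2: "1 / 16 \<le> \<xi>\<^sup>2" using power_mono[of "1/4" \<xi> 2] \<xi> by (simp add: power_divide)
  have n1: "1 \<le> n\<^sup>2" using n by (simp add: one_le_power)
  have t1: "t \<le> 1"
  proof -
    have "1 * t \<le> (8 * n\<^sup>2) * t" using n1 t by (intro mult_right_mono) auto
    then show ?thesis using t by simp
  qed
  have low: "(t / 4) * (1 / (256 * pi)) * indicator {0..t / 2} t' \<le> - Re (?K t')" for t'
  proof (cases "t' \<in> {0..t}")
    case True
    then have t': "0 \<le> t'" "t' \<le> t" by auto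
    \<comment> \<open>The bound on the phases holds at all earlier times.\<close>
    have "8 * n\<^sup>2 * t' \<le> 8 * n\<^sup>2 * t" using t' by (intro mult_left_mono) auto
    then obtain h where h: "1 / 8 \<le> h" and conv: "conv (cos_symbol ?g t') (cos_symbol ?g t') \<xi> = of_real h"
      using conv_high_band_ge[OF n t'(1) _ \<xi>] t by auto
    have sym: "integrand_symbol ?g t t' \<xi>
        = of_real (- (sin ((t - t') * \<gamma> \<xi>) / \<gamma> \<xi> * (\<xi>\<^sup>2 * (h / (2 * pi)))))"
    proof -
      have "\<i> * of_real \<xi> * (\<i> * of_real \<xi> * z) = - of_real (\<xi>\<^sup>2) * z" for z
        by (simp add: complex_eq_iff power2_eq_square algebra_simps)
      then show ?thesis by (simp only: integrand_symbol_def square_symbol_def conv) simp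
    qed
    have "(t - t') * \<gamma> \<xi> \<le> 1 * 1" using t' t1 \<gamma>1 \<gamma>0 by (intro mult_mono) auto
    then have "(t - t') * \<gamma> \<xi> / 2 \<le> sin ((t - t') * \<gamma> \<xi>)"
      using t' \<gamma>0 by (intro half_le_sin) auto
    then have s: "(t - t') / 2 \<le> sin ((t - t') * \<gamma> \<xi>) / \<gamma> \<xi>"
      using \<gamma>0 by (simp add: pos_le_divide_eq)
    have "(1 / 16) * ((1 / 8) / (2 * pi)) \<le> \<xi>\<^sup>2 * (h / (2 * pi))"
      using \<xi>2 h by (intro mult_mono divide_right_mono) auto
    then have "(t - t') / 2 * ((1 / 16) * ((1 / 8) / (2 * pi)))
        \<le> sin ((t - t') * \<gamma> \<xi>) / \<gamma> \<xi> * (\<xi>\<^sup>2 * (h / (2 * pi)))"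
      by (rule mult_mono'[OF s]) (use t' in auto)
    moreover have "(t / 4) * (1 / (256 * pi)) * indicator {0..t / 2} t'
        \<le> (t - t') / 2 * ((1 / 16) * ((1 / 8) / (2 * pi)))"
    proof (cases "t' \<in> {0..t / 2}")
      case True
      then have "(t / 4) * (1 / (256 * pi)) \<le> (t - t') / 2 * (1 / (256 * pi))"
        by (intro mult_right_mono) auto
      with True show ?thesis by simp
    qed (use t' in simp)
    ultimately show ?thesis using True by (simp only: sym) simp
  next
    case False
    then have "t' \<notin> {0..t / 2}" using t by auto
    with False show ?thesis by simp
  qed
  have "t\<^sup>2 / (2048 * pi) = (\<integral>t'. (t / 4) * (1 / (256 * pi)) * indicator {0..t / 2} t' \<partial>lborel)"
    using t by (simp add: power2_eq_square)
  also have "\<dots> \<le> (\<integral>t'. - Re (?K t') \<partial>lborel)"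
  proof (rule integral_mono)
    show "integrable lborel (\<lambda>t'. (t / 4) * (1 / (256 * pi)) * indicator {0..t / 2} t' :: real)"
      using t by simp
    show "integrable lborel (\<lambda>t'. - Re (?K t'))"
      by (intro Bochner_Integration.integrable_minus integrable_Re K)
  qed (rule low)
  also have "\<dots> = - Re (duhamel_symbol ?g t \<xi>)"
    unfolding duhamel_symbol_def Bochner_Integration.integral_minus integral_Re[OF K] ..
  also have "\<dots> \<le> norm (duhamel_symbol ?g t \<xi>)"
    using abs_Re_le_cmod[of "duhamel_symbol ?g t \<xi>"] by linarith
  finally show ?thesis .
qed

section \<open>Sobolev norms and the contradiction\<close>

lemma bracket_powr_le_1: "s \<le> 0 \<Longrightarrow> bracket \<xi> powr s \<le> 1"
proof -
  assume "s \<le> 0"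
  moreover have "1 \<le> bracket \<xi>" "bracket \<xi> \<noteq> 0" by (auto simp: bracket_def add_nonneg_eq_0_iff)
  ultimately show ?thesis using powr_mono[of s 0 "bracket \<xi>"] by simp
qed

lemma sobolev_weight_integrable:
  assumes h: "band_limited R C h" and R: "0 \<le> R" and s: "s \<le> 0"
  shows "integrable lborel (\<lambda>\<xi>. (bracket \<xi> powr s * norm (h \<xi>))\<^sup>2)"
    and "(\<integral>\<xi>. (bracket \<xi> powr s * norm (h \<xi>))\<^sup>2 \<partial>lborel) \<le> 2 * R * C\<^sup>2"
proof -
  have [measurable]: "h \<in> borel_measurable borel" using h by (rule band_limited_measurable)
  have I: "integrable lborel (\<lambda>\<xi>. C\<^sup>2 * indicator {-R..R} \<xi> :: real)" using R by simp
  have le: "(bracket \<xi> powr s * norm (h \<xi>))\<^sup>2 \<le> C\<^sup>2 * indicator {-R..R} \<xi>" for \<xi>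
  proof -
    have "bracket \<xi> powr s * norm (h \<xi>) \<le> 1 * (C * indicator {-R..R} \<xi>)"
      using bracket_powr_le_1[OF s] by (intro mult_mono band_limited_norm[OF h]) auto
    then have "(bracket \<xi> powr s * norm (h \<xi>))\<^sup>2 \<le> (1 * (C * indicator {-R..R} \<xi>))\<^sup>2"
      by (intro power_mono) auto
    then show ?thesis by (cases "\<xi> \<in> {-R..R}") (simp_all add: power_mult_distrib)
  qed
  show i: "integrable lborel (\<lambda>\<xi>. (bracket \<xi> powr s * norm (h \<xi>))\<^sup>2)"
    by (rule Bochner_Integration.integrable_bound[OF I]) (use le in \<open>auto simp: bracket_def\<close>)
  have "(\<integral>\<xi>. (bracket \<xi> powr s * norm (h \<xi>))\<^sup>2 \<partial>lborel) \<le> (\<integral>\<xi>. C\<^sup>2 * indicator {-R..R} \<xi> \<partial>lborel)"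
    by (rule integral_mono[OF i I le])
  then show "(\<integral>\<xi>. (bracket \<xi> powr s * norm (h \<xi>))\<^sup>2 \<partial>lborel) \<le> 2 * R * C\<^sup>2"
    using R by (simp add: mult_ac)
qed

lemma inv_fourier_dist_sobolev:
  assumes h: "band_limited R C h" and R: "0 \<le> R" and s: "s \<le> 0"
  shows "inv_fourier_dist h \<in> sobolev s"
  using sobolev_weight_integrable(1)[OF assms] has_fourier_inv_fourier_dist[OF band_limited_integrable[OF h]]
    inv_fourier_dist_tempered[OF band_limited_integrable[OF h]]
  by (auto simp: sobolev_def)

lemma sobolev_norm_inv_fourier_dist:
  assumes "band_limited R C h"
  shows "sobolev_norm s (inv_fourier_dist h) = sqrt (\<integral>\<xi>. (bracket \<xi> powr s * norm (h \<xi>))\<^sup>2 \<partial>lborel)"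
  by (rule sobolev_norm_eq[OF has_fourier_inv_fourier_dist[OF band_limited_integrable[OF assms]]])

text \<open>The interval \<open>{1/4..1/2}\<close> has length \<open>1 / 4\<close>, and the weight there is at least \<open>2 powr s\<close>.\<close>

lemma sobolev_norm_ge:
  assumes h: "band_limited R C h" and R: "0 \<le> R" and s: "s \<le> 0" and c: "0 \<le> c"
    and low: "\<And>\<xi>. \<xi> \<in> {1/4..1/2} \<Longrightarrow> c \<le> norm (h \<xi>)"
  shows "2 powr s * c / 2 \<le> sobolev_norm s (inv_fourier_dist h)"
  unfolding sobolev_norm_inv_fourier_dist[OF h]
proof (rule real_le_rsqrt)
  have "(2 powr s * c / 2)\<^sup>2 = (\<integral>\<xi>. (2 powr s * c)\<^sup>2 * indicator {1/4..1/2::real} \<xi> \<partial>lborel)"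
    by (simp add: power_divide)
  also have "\<dots> \<le> (\<integral>\<xi>. (bracket \<xi> powr s * norm (h \<xi>))\<^sup>2 \<partial>lborel)"
  proof (rule integral_mono[OF _ sobolev_weight_integrable(1)[OF h R s]])
    fix \<xi> :: real
    show "(2 powr s * c)\<^sup>2 * indicator {1/4..1/2} \<xi> \<le> (bracket \<xi> powr s * norm (h \<xi>))\<^sup>2"
    proof (cases "\<xi> \<in> {1/4..1/2}")
      case True
      then have "2 powr s \<le> bracket \<xi> powr s"
        using s by (intro powr_mono2') (auto simp: bracket_def)
      then have "(2 powr s * c)\<^sup>2 \<le> (bracket \<xi> powr s * norm (h \<xi>))\<^sup>2"
        using low[OF True] c by (intro power_mono mult_mono) auto
      with True show ?thesis by simp
    qed simp
  qed simp
  finally show "(2 powr s * c / 2)\<^sup>2 \<le> (\<integral>\<xi>. (bracket \<xi> powr s * norm (h \<xi>))\<^sup>2 \<partial>lborel)" .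
qed

text \<open>The band has measure \<open>2\<close>, and all its frequencies have modulus at least \<open>n\<close>.\<close>

lemma sobolev_norm_high_band_le:
  assumes n: "1 \<le> n" and s: "s \<le> 0"
  shows "sobolev_norm s (inv_fourier_dist (indicator (high_band n))) \<le> 2 * n powr s"
proof -
  have g: "band_limited (n + 1) 1 (indicator (high_band n))"
    using n by (intro high_band_band_limited) simp
  have "(\<integral>\<xi>. (bracket \<xi> powr s * norm (indicator (high_band n) \<xi> :: complex))\<^sup>2 \<partial>lborel)
     \<le> (\<integral>\<xi>. (n powr s)\<^sup>2 * (indicator {- (n + 1)..- n} \<xi> + indicator {n..n + 1} \<xi>) \<partial>lborel)"
  proof (rule integral_mono)
    show "integrable lborel (\<lambda>\<xi>. (bracket \<xi> powr s * norm (indicator (high_band n) \<xi> :: complex))\<^sup>2)"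
      by (rule sobolev_weight_integrable[OF g]) (use n s in auto)
    show "integrable lborel (\<lambda>\<xi>. (n powr s)\<^sup>2 * (indicator {- (n + 1)..- n} \<xi> + indicator {n..n + 1} \<xi>) :: real)"
      by (intro integrable_mult_right Bochner_Integration.integrable_add) auto
    fix \<xi> :: real
    show "(bracket \<xi> powr s * norm (indicator (high_band n) \<xi> :: complex))\<^sup>2
      \<le> (n powr s)\<^sup>2 * (indicator {- (n + 1)..- n} \<xi> + indicator {n..n + 1} \<xi>)"
    proof (cases "\<xi> \<in> high_band n")
      case True
      then have "bracket \<xi> powr s \<le> n powr s"
        using s n by (intro powr_mono2') (auto simp: bracket_def high_band_def)
      then have "(bracket \<xi> powr s)\<^sup>2 \<le> (n powr s)\<^sup>2" by (intro power_mono) auto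
      moreover have "(1::real) \<le> indicator {- (n + 1)..- n} \<xi> + indicator {n..n + 1} \<xi>"
        using True by (auto simp: high_band_def indicator_def)
      ultimately have "(bracket \<xi> powr s)\<^sup>2 * 1
          \<le> (n powr s)\<^sup>2 * (indicator {- (n + 1)..- n} \<xi> + indicator {n..n + 1} \<xi>)"
        by (intro mult_mono) auto
      with True show ?thesis by simp
    qed simp
  qed
  also have "\<dots> = (n powr s)\<^sup>2 * 2"
    by (subst integral_mult_right_zero, subst Bochner_Integration.integral_add) auto
  also have "\<dots> \<le> (2 * n powr s)\<^sup>2" by (simp add: power_mult_distrib)
  finally have "(\<integral>\<xi>. (bracket \<xi> powr s * norm (indicator (high_band n) \<xi> :: complex))\<^sup>2 \<partial>lborel)
     \<le> (2 * n powr s)\<^sup>2" .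
  then show ?thesis
    unfolding sobolev_norm_inv_fourier_dist[OF g] by (rule real_le_lsqrt[rotated]) simp
qed

text \<open>The supremum over time is at least the value at \<open>t\<close>, provided that the norms are bounded in time;
  this follows from the uniform bound on the symbol.\<close>

lemma C_sobolev_norm_duhamel_ge:
  assumes n: "1 \<le> n" and t: "t = 1 / (8 * n\<^sup>2)" "t \<le> T" and s: "s \<le> 0"
    and w: "w = duhamel T (free_wave (indicator (high_band n))) (free_wave (indicator (high_band n)))"
  shows "2 powr s * (t\<^sup>2 / (2048 * pi)) / 2 \<le> C_sobolev_norm T s w"
proof -
  let ?g = "indicator (high_band n) :: real \<Rightarrow> complex"
  have g: "band_limited (n + 1) 1 ?g" using n by (intro high_band_band_limited) simp
  have R: "0 \<le> n + 1" using n by simp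
  have t0: "0 \<le> t" "8 * n\<^sup>2 * t \<le> 1" using n t by auto
  have w_eq: "w \<tau> = inv_fourier_dist (duhamel_symbol ?g \<tau>)" if "\<tau> \<in> {0..T}" for \<tau>
    unfolding w by (rule duhamel_free_wave[OF g R that])
  have bl: "band_limited (2 * (n + 1)) (\<tau>\<^sup>2 * (4 * (n + 1) ^ 3)) (duhamel_symbol ?g \<tau>)" if "0 \<le> \<tau>" for \<tau>
    by (rule duhamel_symbol_band_limited[OF g R that])
  have "2 powr s * (t\<^sup>2 / (2048 * pi)) / 2 \<le> sobolev_norm s (inv_fourier_dist (duhamel_symbol ?g t))"
    by (rule sobolev_norm_ge[OF bl[OF t0(1)] _ s]) (use R duhamel_symbol_high_band_ge[OF n t0] in auto)
  also have "\<dots> = sobolev_norm s (w t)" using w_eq[of t] t0 t(2) by simp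
  also have "\<dots> \<le> C_sobolev_norm T s w"
    unfolding C_sobolev_norm_def
  proof (rule cSUP_upper)
    show "bdd_above ((\<lambda>\<tau>. sobolev_norm s (w \<tau>)) ` {0..T})"
    proof (rule bdd_aboveI2)
      fix \<tau> assume \<tau>: "\<tau> \<in> {0..T}"
      then have b: "band_limited (2 * (n + 1)) (\<tau>\<^sup>2 * (4 * (n + 1) ^ 3)) (duhamel_symbol ?g \<tau>)"
        by (intro bl) simp
      have "sobolev_norm s (w \<tau>) \<le> sqrt (2 * (2 * (n + 1)) * (\<tau>\<^sup>2 * (4 * (n + 1) ^ 3))\<^sup>2)"
        unfolding w_eq[OF \<tau>] sobolev_norm_inv_fourier_dist[OF b]
        by (intro real_sqrt_le_mono sobolev_weight_integrable(2)[OF b _ s]) (use R in simp)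
      also have "\<dots> \<le> sqrt (2 * (2 * (n + 1)) * (T\<^sup>2 * (4 * (n + 1) ^ 3))\<^sup>2)"
        using R \<tau> by (intro real_sqrt_le_mono mult_left_mono power_mono mult_right_mono) auto
      finally show "sobolev_norm s (w \<tau>) \<le> sqrt (2 * (2 * (n + 1)) * (T\<^sup>2 * (4 * (n + 1) ^ 3))\<^sup>2)" .
    qed
  qed (use t0 t in auto)
  finally show ?thesis .
qed

theorem theorem1p4:
  fixes s T :: real
  assumes "s < -2" and "T > 0"
  shows "\<not> (\<exists>(X :: (real \<Rightarrow> functional) set) (N :: (real \<Rightarrow> functional) \<Rightarrow> real)
              (B :: (real \<Rightarrow> functional) \<Rightarrow> (real \<Rightarrow> functional) \<Rightarrow> real \<Rightarrow> functional) (c :: real).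
           normed_dist_space T X N \<and> duhamel_interpretation T X B \<and> c > 0 \<and>
           (\<forall>u\<in>X. u \<in> C_sobolev T s \<and> C_sobolev_norm T s u \<le> c * N u) \<and>
           (\<forall>\<phi>\<in>sobolev s. \<forall>\<psi>\<in>sobolev (s - 1).
              on_interval T (\<lambda>t f. Vc t \<phi> f + Vs t (dist_deriv \<psi>) f) \<in> X \<and>
              N (on_interval T (\<lambda>t f. Vc t \<phi> f + Vs t (dist_deriv \<psi>) f))
                \<le> c * (sobolev_norm s \<phi> + sobolev_norm (s - 1) \<psi>)) \<and>
           (\<forall>u\<in>X. \<forall>v\<in>X. B u v \<in> X \<and> N (B u v) \<le> c * N u * N v))"
proof
  assume "\<exists>(X :: (real \<Rightarrow> functional) set) (N :: (real \<Rightarrow> functional) \<Rightarrow> real)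
              (B :: (real \<Rightarrow> functional) \<Rightarrow> (real \<Rightarrow> functional) \<Rightarrow> real \<Rightarrow> functional) (c :: real).
           normed_dist_space T X N \<and> duhamel_interpretation T X B \<and> c > 0 \<and>
           (\<forall>u\<in>X. u \<in> C_sobolev T s \<and> C_sobolev_norm T s u \<le> c * N u) \<and>
           (\<forall>\<phi>\<in>sobolev s. \<forall>\<psi>\<in>sobolev (s - 1).
              on_interval T (\<lambda>t f. Vc t \<phi> f + Vs t (dist_deriv \<psi>) f) \<in> X \<and>
              N (on_interval T (\<lambda>t f. Vc t \<phi> f + Vs t (dist_deriv \<psi>) f))
                \<le> c * (sobolev_norm s \<phi> + sobolev_norm (s - 1) \<psi>)) \<and>
           (\<forall>u\<in>X. \<forall>v\<in>X. B u v \<in> X \<and> N (B u v) \<le> c * N u * N v)"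
  then obtain X and N :: "(real \<Rightarrow> functional) \<Rightarrow> real" and B and c :: real where
    X: "normed_dist_space T X N" and B: "duhamel_interpretation T X B" and c: "c > 0"
    and emb: "\<And>u. u \<in> X \<Longrightarrow> C_sobolev_norm T s u \<le> c * N u"
    and lin: "\<And>\<phi> \<psi>. \<phi> \<in> sobolev s \<Longrightarrow> \<psi> \<in> sobolev (s - 1) \<Longrightarrow>
        on_interval T (\<lambda>t f. Vc t \<phi> f + Vs t (dist_deriv \<psi>) f) \<in> X \<and>
        N (on_interval T (\<lambda>t f. Vc t \<phi> f + Vs t (dist_deriv \<psi>) f))
          \<le> c * (sobolev_norm s \<phi> + sobolev_norm (s - 1) \<psi>)"
    and bil: "\<And>u v. u \<in> X \<Longrightarrow> v \<in> X \<Longrightarrow> B u v \<in> X \<and> N (B u v) \<le> c * N u * N v"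
    by blast
  have s0: "s \<le> 0" using assms by simp
  \<comment> \<open>With \<open>t = 1 / (8 * n\<^sup>2)\<close> the lower bound for the Duhamel term is \<open>K * n powr (- 4)\<close>.\<close>
  define K where "K = 2 powr s / (2 * 2048 * pi * 64)"
  have K: "K > 0" by (simp add: K_def)
  have bound: "n powr (- 4 - 2 * s) \<le> 4 * c ^ 4 / K" if n: "1 \<le> n" "1 / T \<le> n" for n
  proof -
    let ?g = "indicator (high_band n) :: real \<Rightarrow> complex"
    define u where "u = on_interval T (\<lambda>t. inv_fourier_dist (cos_symbol ?g t))"
    define t where "t = 1 / (8 * n\<^sup>2)"
    have g: "band_limited (n + 1) 1 ?g" using n by (intro high_band_band_limited) simp
    have R: "0 \<le> n + 1" using n by simp
    have "u \<in> X \<and> N u \<le> c * (sobolev_norm s (inv_fourier_dist ?g) + sobolev_norm (s - 1) (\<lambda>_. 0))"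
      using lin[OF inv_fourier_dist_sobolev[OF g R s0] zero_sobolev]
      unfolding free_solution_eq[OF g] u_def .
    then have uX: "u \<in> X" and "N u \<le> c * sobolev_norm s (inv_fourier_dist ?g)"
      by (auto simp: sobolev_norm_zero)
    moreover have "c * sobolev_norm s (inv_fourier_dist ?g) \<le> c * (2 * n powr s)"
      using c by (intro mult_left_mono sobolev_norm_high_band_le n s0) auto
    ultimately have Nu: "N u \<le> c * (2 * n powr s)" by linarith
    have Nu0: "0 \<le> N u" using X uX by (auto simp: normed_dist_space_def)
    have "smooth_rep T u (free_wave ?g)" unfolding u_def by (rule smooth_rep_free_wave[OF g])
    then have Buu: "B u u = duhamel T (free_wave ?g) (free_wave ?g)"
      using B uX duhamel_defined_free_wave[OF g R] unfolding duhamel_interpretation_def by blast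
    have "1 / (8 * n\<^sup>2) \<le> 1 / n"
      using n by (intro divide_left_mono) (auto simp: power2_eq_square)
    also have "1 / n \<le> T" using n assms by (simp add: field_simps)
    finally have "t \<le> T" by (simp add: t_def)
    \<comment> \<open>The hypotheses on the space bound the left-hand side from above by the square of the data norm.\<close>
    from C_sobolev_norm_duhamel_ge[OF n(1) t_def this s0 Buu]
    have "2 powr s * (t\<^sup>2 / (2048 * pi)) / 2 \<le> C_sobolev_norm T s (B u u)" .
    also have "\<dots> \<le> c * N (B u u)" using bil uX by (intro emb) auto
    also have "\<dots> \<le> c * (c * N u * N u)" using bil uX c by (intro mult_left_mono) auto
    also have "\<dots> \<le> c * (c * (c * (2 * n powr s)) * (c * (2 * n powr s)))"
      using Nu Nu0 c by (intro mult_left_mono mult_mono) auto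
    also have "\<dots> = 4 * c ^ 4 * (n powr s * n powr s)" by (simp add: power4_eq_xxxx)
    also have "n powr s * n powr s = n powr (2 * s)" by (simp add: powr_add[symmetric])
    also have "2 powr s * (t\<^sup>2 / (2048 * pi)) / 2 = K * n powr (- 4)"
    proof -
      have "n powr (- 4) = 1 / n ^ 4" using n by (simp add: powr_minus_divide)
      then show ?thesis by (simp add: K_def t_def power_divide power_mult_distrib flip: power_mult)
    qed
    finally have "K * n powr (- 4) * n powr (- 2 * s) \<le> 4 * c ^ 4 * n powr (2 * s) * n powr (- 2 * s)"
      by (intro mult_right_mono) auto
    then have "K * n powr (- 4 - 2 * s) \<le> 4 * c ^ 4"
      using n by (simp add: mult.assoc powr_add[symmetric])
    then show ?thesis using K by (simp add: pos_le_divide_eq mult.commute)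
  qed
  \<comment> \<open>Since \<open>- 4 - 2 * s > 0\<close>, the left-hand side of the bound exceeds the constant for large \<open>n\<close>.\<close>
  define M where "M = 4 * c ^ 4 / K"
  define n where "n = (M + 1) powr (1 / (- 4 - 2 * s)) + 1 + 1 / T"
  have "M > 0" using c K by (simp add: M_def)
  then have "M + 1 = ((M + 1) powr (1 / (- 4 - 2 * s))) powr (- 4 - 2 * s)"
    using assms by (simp add: powr_powr)
  also have "\<dots> \<le> n powr (- 4 - 2 * s)"
    using assms by (intro powr_mono2) (auto simp: n_def)
  finally have "M < n powr (- 4 - 2 * s)" by simp
  moreover have "1 \<le> n" "1 / T \<le> n" using assms by (auto simp: n_def)
  ultimately show False using bound[of n] by (simp add: M_def)
qed

end
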